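(* The $\mathcal{L}$-order on $\mathrm{Stell}_n^0$ is a sublattice of the $\mathcal{L}$-order of $R_n^0$.
   Context: Rooks of size $n$ are words $r=r_1\dots r_n$ over $\{0,\dots,n\}$ with pairwise distinct nonzero letters; $R_n$ is their set, $1_n=12\cdots n$. $R_n^0$ is the monoid presented by generators $\pi_0,\dots,\pi_{n-1}$ and relations $\pi_i^2=\pi_i$, $\pi_i\pi_{i+1}\pi_i=\pi_{i+1}\pi_i\pi_{i+1}$ ($1\le i\le n-2$), $\pi_1\pi_0\pi_1\pi_0=\pi_0\pi_1\pi_0=\pi_0\pi_1\pi_0\pi_1$, $\pi_i\pi_j=\pi_j\pi_i$ ($|i-j|\ge2$); it acts on the right on $R_n$ by $r\cdot\pi_0=0r_2\cdots r_n$ and, for $k\ge1$, $r\cdot\pi_k$ exchanges $r_k,r_{k+1}$ if $r_k<r_{k+1}$ and fixes $r$ otherwise, and each element of $R_n^0$ is $\pi_r$ for a unique rook $r$ with $1_n\cdot\pi_r=r$. In a monoid $M$, $x\le_{\mathcal{L}}y$ means $Mx\subseteq My$; for $R_n^0$ this is a lattice order. For a rook $r$ let $M(r)=\max\{i\in\{1,\dots,n\}: i\notin r\}$ and let $\mathrm{St}(r)$ replace by $0$ every letter of $r$ smaller than $M(r)$ ($\mathrm{St}(r)=r$ if no letter is missing). Let $\mathrm{Stell}_n=\mathrm{St}(R_n)$, $\mathrm{St}^0(\pi_r)=\pi_{\mathrm{St}(r)}$; there is a unique monoid structure on $\mathrm{Stell}_n^0=\{\pi_s:s\in\mathrm{Stell}_n\}\subseteq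 R_n^0$ making $\mathrm{St}^0:R_n^0\to\mathrm{Stell}_n^0$ a surjective monoid morphism, and $\mathrm{Stell}_n^0$ denotes this monoid, viewed as a subset of $R_n^0$. *)

theory Defs
  imports "HOL-Algebra.Coset"
begin

section \<open>Monoids given by generators and relations\<close>

text \<open>The congruence on words over \<open>A\<close> generated by the pairs in \<open>Rel\<close>.\<close>

inductive_set word_cong :: "'g set \<Rightarrow> ('g list \<times> 'g list) set \<Rightarrow> ('g list \<times> 'g list) set"
  for A :: "'g set" and Rel :: "('g list \<times> 'g list) set" where
  base: "(u, v) \<in> Rel \<Longrightarrow> u \<in> lists A \<Longrightarrow> v \<in> lists A \<Longrightarrow> (u, v) \<in> word_cong A Rel"
| refl: "w \<in> lists A \<Longrightarrow> (w, w) \<in> word_cong A Rel"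
| sym: "(u, v) \<in> word_cong A Rel \<Longrightarrow> (v, u) \<in> word_cong A Rel"
| trans: "(u, v) \<in> word_cong A Rel \<Longrightarrow> (v, w) \<in> word_cong A Rel \<Longrightarrow> (u, w) \<in> word_cong A Rel"
| append: "(u, u') \<in> word_cong A Rel \<Longrightarrow> (v, v') \<in> word_cong A Rel
    \<Longrightarrow> (u @ v, u' @ v') \<in> word_cong A Rel"

definition presented_monoid :: "'g set \<Rightarrow> ('g list \<times> 'g list) set \<Rightarrow> 'g list set monoid" where
  "presented_monoid A Rel =
     \<lparr>carrier = lists A // word_cong A Rel,
      mult = (\<lambda>X Y. \<Union>x\<in>X. \<Union>y\<in>Y. word_cong A Rel `` {x @ y}),
      one = word_cong A Rel `` {[]}\<rparr>"

lemma word_cong_lists: "(u, v) \<in> word_cong A Rel \<Longrightarrow> u \<in> lists A \<and> v \<in> lists A"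
  by (induction rule: word_cong.induct) auto

lemma equiv_word_cong: "equiv (lists A) (word_cong A Rel)"
proof (rule equivI)
  show "word_cong A Rel \<subseteq> lists A \<times> lists A"
    using word_cong_lists by fast
  show "refl_on (lists A) (word_cong A Rel)"
    by (rule refl_onI) (rule word_cong.refl)
  show "sym (word_cong A Rel)"
    by (rule symI) (rule word_cong.sym)
  show "trans (word_cong A Rel)"
    by (rule transI) (rule word_cong.trans)
qed

lemma presented_monoid_mult:
  assumes "u \<in> lists A" and "v \<in> lists A"
  shows "(word_cong A Rel `` {u}) \<otimes>\<^bsub>presented_monoid A Rel\<^esub> (word_cong A Rel `` {v})
       = word_cong A Rel `` {u @ v}"
proof -
  have eq: "word_cong A Rel `` {x @ y} = word_cong A Rel `` {u @ v}"
    if "x \<in> word_cong A Rel `` {u}" "y \<in> word_cong A Rel `` {v}" for x y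
  proof (rule equiv_class_eq [OF equiv_word_cong])
    show "(x @ y, u @ v) \<in> word_cong A Rel"
      using that unfolding Image_singleton_iff
      by (intro word_cong.append) (rule word_cong.sym, assumption)+
  qed
  have "u \<in> word_cong A Rel `` {u}" "v \<in> word_cong A Rel `` {v}"
    using assms by (auto intro: word_cong.refl)
  moreover have "(word_cong A Rel `` {u}) \<otimes>\<^bsub>presented_monoid A Rel\<^esub> (word_cong A Rel `` {v})
      = (\<Union>x\<in>word_cong A Rel `` {u}. \<Union>y\<in>word_cong A Rel `` {v}. word_cong A Rel `` {u @ v})"
    unfolding presented_monoid_def monoid.simps by (intro SUP_cong HOL.refl eq)
  ultimately show ?thesis by fast
qed

lemma monoid_presented_monoid: "monoid (presented_monoid A Rel)"
proof -
  let ?M = "presented_monoid A Rel"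
  have car: "\<exists>w \<in> lists A. X = word_cong A Rel `` {w}" if "X \<in> carrier ?M" for X
    using that by (auto simp: presented_monoid_def quotient_def)
  have carI: "word_cong A Rel `` {w} \<in> carrier ?M" if "w \<in> lists A" for w
    using that by (auto simp: presented_monoid_def quotient_def)
  have one: "\<one>\<^bsub>?M\<^esub> = word_cong A Rel `` {[]}"
    by (simp add: presented_monoid_def)
  show ?thesis
  proof (rule monoidI)
    fix X Y assume "X \<in> carrier ?M" "Y \<in> carrier ?M"
    then obtain u v where "u \<in> lists A" "v \<in> lists A"
      "X = word_cong A Rel `` {u}" "Y = word_cong A Rel `` {v}"
      using car by metis
    moreover from this have "u @ v \<in> lists A" by simp
    ultimately show "X \<otimes>\<^bsub>?M\<^esub> Y \<in> carrier ?M"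
      by (simp only: presented_monoid_mult carI)
  next
    show "\<one>\<^bsub>?M\<^esub> \<in> carrier ?M"
      unfolding one by (rule carI) simp
  next
    fix X Y Z assume "X \<in> carrier ?M" "Y \<in> carrier ?M" "Z \<in> carrier ?M"
    then obtain u v w where "u \<in> lists A" "v \<in> lists A" "w \<in> lists A"
      "X = word_cong A Rel `` {u}" "Y = word_cong A Rel `` {v}" "Z = word_cong A Rel `` {w}"
      using car by metis
    moreover from this have "u @ v \<in> lists A" "v @ w \<in> lists A" by simp_all
    ultimately show "X \<otimes>\<^bsub>?M\<^esub> Y \<otimes>\<^bsub>?M\<^esub> Z = X \<otimes>\<^bsub>?M\<^esub> (Y \<otimes>\<^bsub>?M\<^esub> Z)"
      by (simp only: presented_monoid_mult append_assoc)
  next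
    fix X assume "X \<in> carrier ?M"
    then obtain w where w: "w \<in> lists A" "X = word_cong A Rel `` {w}"
      using car by blast
    show "\<one>\<^bsub>?M\<^esub> \<otimes>\<^bsub>?M\<^esub> X = X" "X \<otimes>\<^bsub>?M\<^esub> \<one>\<^bsub>?M\<^esub> = X"
      using presented_monoid_mult [of "[]" A w Rel] presented_monoid_mult [of w A "[]" Rel] w
      by (simp_all add: one)
  qed
qed


section \<open>Rooks and the 0-rook monoid\<close>

text \<open>A rook is a list \<open>[r\<^sub>1, \<dots>, r\<^sub>n]\<close>; the letter \<open>r\<^sub>k\<close> is \<open>r ! (k - 1)\<close>.\<close>

definition rooks :: "nat \<Rightarrow> nat list set" where
  "rooks n = {r. length r = n \<and> set r \<subseteq> {0..n} \<and> distinct (filter (\<lambda>x. x \<noteq> 0) r)}"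

definition id_rook :: "nat \<Rightarrow> nat list" where
  "id_rook n = [1..<Suc n]"

definition rook_rels :: "nat \<Rightarrow> (nat list \<times> nat list) set" where
  "rook_rels n =
     {([i, i], [i]) | i. i < n}
   \<union> {([i, Suc i, i], [Suc i, i, Suc i]) | i. 1 \<le> i \<and> i + 2 \<le> n}
   \<union> (if 2 \<le> n then {([1, 0, 1, 0], [0, 1, 0]), ([0, 1, 0], [0, 1, 0, 1])} else {})
   \<union> {([i, j], [j, i]) | i j. i < n \<and> j < n \<and> (i + 2 \<le> j \<or> j + 2 \<le> i)}"

definition rook0_monoid :: "nat \<Rightarrow> nat list set monoid" where
  "rook0_monoid n = presented_monoid {..<n} (rook_rels n)"

definition gen_act :: "nat list \<Rightarrow> nat \<Rightarrow> nat list" where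
  "gen_act r k =
     (if k = 0 then r[0 := 0]
      else if r ! (k - 1) < r ! k then r[k - 1 := r ! k, k := r ! (k - 1)]
      else r)"

definition word_act :: "nat list \<Rightarrow> nat list \<Rightarrow> nat list" where
  "word_act r w = foldl gen_act r w"

text \<open>The right action of an element of the presented monoid, computed on any representative;
  independence of the representative is shown below.\<close>

definition rook_act :: "nat list \<Rightarrow> nat list set \<Rightarrow> nat list" where
  "rook_act r X = word_act r (SOME w. w \<in> X)"

lemma length_gen_act [simp]: "length (gen_act r k) = length r"
  by (simp add: gen_act_def)

lemma length_word_act [simp]: "length (word_act r w) = length r"
  unfolding word_act_def by (induction w arbitrary: r) auto

lemma word_act_append: "word_act r (u @ v) = word_act (word_act r u) v"
  by (simp add: word_act_def)

lemma gen_act_nth: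
  assumes "k < length r" "i < length r"
  shows "gen_act r k ! i =
    (if k = 0 then (if i = 0 then 0 else r ! i)
     else if i = k - 1 then max (r ! (k - 1)) (r ! k)
     else if i = k then min (r ! (k - 1)) (r ! k)
     else r ! i)"
  using assms by (auto simp: gen_act_def nth_list_update)

lemma word_act_idem: "i < length r \<Longrightarrow> word_act r [i, i] = word_act r [i]"
  by (rule nth_equalityI) (auto simp: word_act_def gen_act_nth max_def min_def)

lemma word_act_braid:
  assumes "1 \<le> i" "i + 2 \<le> length r"
  shows "word_act r [i, Suc i, i] = word_act r [Suc i, i, Suc i]"
proof (rule nth_equalityI)
  obtain j where j: "i = Suc j"
    using assms(1) by (cases i) auto
  fix k assume k: "k < length (word_act r [i, Suc i, i])"
  consider "k = j" | "k = Suc j" | "k = Suc (Suc j)"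
    | "k \<noteq> j" "k \<noteq> Suc j" "k \<noteq> Suc (Suc j)"
    by blast
  then show "word_act r [i, Suc i, i] ! k = word_act r [Suc i, i, Suc i] ! k"
    using assms(2) k unfolding j
    by cases (simp_all add: word_act_def gen_act_nth max_def min_def)
qed simp

lemma word_act_zero:
  assumes "2 \<le> length r"
  shows "word_act r [1, 0, 1, 0] = word_act r [0, 1, 0]"
    and "word_act r [0, 1, 0] = word_act r [0, 1, 0, 1]"
proof -
  obtain a b s where "r = a # b # s"
    using assms by (auto simp: numeral_2_eq_2 Suc_le_length_iff)
  then show "word_act r [1, 0, 1, 0] = word_act r [0, 1, 0]"
    "word_act r [0, 1, 0] = word_act r [0, 1, 0, 1]"
    by (simp_all add: word_act_def gen_act_def)
qed

lemma word_act_comm: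
  assumes "i < length r" "j < length r" "i + 2 \<le> j"
  shows "word_act r [i, j] = word_act r [j, i]"
proof -
  obtain j' where j: "j = Suc j'" "i < j'"
    using assms(3) by (cases j) auto
  show ?thesis
  proof (cases i)
    case 0
    with j show ?thesis
      by (simp add: word_act_def gen_act_def list_update_swap)
  next
    case (Suc i')
    with j have "i' \<noteq> j'" "i' \<noteq> Suc j'" "Suc i' \<noteq> j'" "Suc i' \<noteq> Suc j'"
      by auto
    with j Suc show ?thesis
      by (simp add: word_act_def gen_act_def list_update_swap)
  qed
qed

lemma word_act_rel:
  assumes "(u, v) \<in> rook_rels n" "length r = n"
  shows "word_act r u = word_act r v"
proof -
  from assms(1) have
    "(\<exists>i<n. u = [i, i] \<and> v = [i])
   \<or> (\<exists>i. 1 \<le> i \<and> i + 2 \<le> n \<and> u = [i, Suc i, i] \<and> v = [Suc i, i, Suc i])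
   \<or> (2 \<le> n \<and> u = [1, 0, 1, 0] \<and> v = [0, 1, 0])
   \<or> (2 \<le> n \<and> u = [0, 1, 0] \<and> v = [0, 1, 0, 1])
   \<or> (\<exists>i<n. \<exists>j<n. (i + 2 \<le> j \<or> j + 2 \<le> i) \<and> u = [i, j] \<and> v = [j, i])"
    by (cases "2 \<le> n") (simp_all add: rook_rels_def, blast+)
  then show ?thesis
  proof (elim disjE exE conjE)
    fix i j assume "i < n" "j < n" "i + 2 \<le> j" "u = [i, j]" "v = [j, i]"
    then show ?thesis using word_act_comm [of i r j] assms(2) by simp
  next
    fix i j assume "i < n" "j < n" "j + 2 \<le> i" "u = [i, j]" "v = [j, i]"
    then show ?thesis using word_act_comm [of j r i] assms(2) by simp
  next
    fix i assume "i < n" "u = [i, i]" "v = [i]"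
    then show ?thesis using word_act_idem [of i r] assms(2) by simp
  next
    fix i assume "1 \<le> i" "i + 2 \<le> n" "u = [i, Suc i, i]" "v = [Suc i, i, Suc i]"
    then show ?thesis using word_act_braid [of i r] assms(2) by simp
  next
    assume "2 \<le> n" "u = [1, 0, 1, 0]" "v = [0, 1, 0]"
    then show ?thesis using word_act_zero(1) [of r] assms(2) by simp
  next
    assume "2 \<le> n" "u = [0, 1, 0]" "v = [0, 1, 0, 1]"
    then show ?thesis using word_act_zero(2) [of r] assms(2) by simp
  qed
qed

lemma word_act_cong:
  assumes "(u, v) \<in> word_cong {..<n} (rook_rels n)" "length r = n"
  shows "word_act r u = word_act r v"
  using assms
proof (induction arbitrary: r rule: word_cong.induct)
  case (base u v)
  show ?case using base.hyps(1) base.prems by (rule word_act_rel)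
next
  case (refl w)
  show ?case by (rule HOL.refl)
next
  case (sym u v)
  show ?case using sym.IH [OF sym.prems] by (rule HOL.sym)
next
  case (trans u v w)
  show ?case using trans.IH(1) [OF trans.prems] trans.IH(2) [OF trans.prems] by (rule HOL.trans)
next
  case (append u u' v v')
  have "word_act (word_act r u) v = word_act (word_act r u) v'"
    by (rule append.IH(2)) (simp add: append.prems)
  with append.IH(1) [OF append.prems] show ?case
    by (simp only: word_act_append)
qed

lemma rook_act_eq:
  assumes "X \<in> carrier (rook0_monoid n)" "w \<in> X" "length r = n"
  shows "rook_act r X = word_act r w"
proof -
  have "(SOME w. w \<in> X) \<in> X"
    using assms(2) by (rule someI)
  then have "((SOME w. w \<in> X), w) \<in> word_cong {..<n} (rook_rels n)"
    using assms(1,2) quotient_eq_iff [OF equiv_word_cong, of X _ _ X]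
    by (simp add: rook0_monoid_def presented_monoid_def)
  then show ?thesis
    unfolding rook_act_def using assms(3) by (rule word_act_cong)
qed

text \<open>\<open>\<pi>\<^sub>r\<close> is the unique \<open>x\<close> with \<open>1\<^sub>n \<cdot> x = r\<close>; meaningful only for \<open>r \<in> rooks n\<close>.\<close>

definition rook_elt :: "nat \<Rightarrow> nat list \<Rightarrow> nat list set" where
  "rook_elt n r = (THE x. x \<in> carrier (rook0_monoid n) \<and> rook_act (id_rook n) x = r)"


section \<open>The stellar monoid\<close>

definition missing :: "nat \<Rightarrow> nat list \<Rightarrow> nat set" where
  "missing n r = {i \<in> {1..n}. i \<notin> set r}"

definition stell_map :: "nat \<Rightarrow> nat list \<Rightarrow> nat list" where
  "stell_map n r =
     (if missing n r = {} then r
      else map (\<lambda>x. if x < Max (missing n r) then 0 else x) r)"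

definition stell_rooks :: "nat \<Rightarrow> nat list set" where
  "stell_rooks n = stell_map n ` rooks n"

definition stell_carrier :: "nat \<Rightarrow> nat list set set" where
  "stell_carrier n = rook_elt n ` stell_rooks n"

text \<open>\<open>St\<^sup>0\<close>; an element \<open>x\<close> is \<open>\<pi>\<^sub>r\<close> for the rook \<open>r = 1\<^sub>n \<cdot> x\<close>.\<close>

definition stell0_map :: "nat \<Rightarrow> nat list set \<Rightarrow> nat list set" where
  "stell0_map n x = rook_elt n (stell_map n (rook_act (id_rook n) x))"

text \<open>Surjectivity of \<open>St\<^sup>0\<close> determines multiplication and unit on the carrier, so the choice
  below is unique up to the irrelevant values of the multiplication outside the carrier.\<close>

definition stell0_monoid :: "nat \<Rightarrow> nat list set monoid" where
  "stell0_monoid n =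
     (SOME G. monoid G \<and> carrier G = stell_carrier n
        \<and> stell0_map n \<in> hom (rook0_monoid n) G
        \<and> stell0_map n ` carrier (rook0_monoid n) = carrier G
        \<and> stell0_map n \<one>\<^bsub>rook0_monoid n\<^esub> = \<one>\<^bsub>G\<^esub>)"


section \<open>The \<open>\<L>\<close>-order and sublattices\<close>

text \<open>\<open>carrier M #> x\<close> is the left ideal \<open>M x\<close>.\<close>

definition L_order :: "('a, 'm) monoid_scheme \<Rightarrow> 'a gorder" where
  "L_order M =
     \<lparr>carrier = carrier M, eq = (=),
      le = (\<lambda>x y. carrier M #>\<^bsub>M\<^esub> x \<subseteq> carrier M #>\<^bsub>M\<^esub> y)\<rparr>"

definition sublattice :: "'a gorder \<Rightarrow> 'a gorder \<Rightarrow> bool" where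
  "sublattice K L \<longleftrightarrow>
     lattice L \<and> carrier K \<subseteq> carrier L
   \<and> (\<forall>x\<in>carrier K. \<forall>y\<in>carrier K.
        (x .=\<^bsub>K\<^esub> y \<longleftrightarrow> x .=\<^bsub>L\<^esub> y) \<and> (x \<sqsubseteq>\<^bsub>K\<^esub> y \<longleftrightarrow> x \<sqsubseteq>\<^bsub>L\<^esub> y)
      \<and> x \<squnion>\<^bsub>L\<^esub> y \<in> carrier K \<and> x \<sqinter>\<^bsub>L\<^esub> y \<in> carrier K)"

end

theory Submission
  imports Defs
begin

text \<open>Transposing rooks turns left multiplication into the right action, so the \<open>\<L>\<close>-order
  becomes reachability under the moves \<open>r \<mapsto> r \<cdot> \<pi>\<^sub>k\<close>. Reachability is characterised by support,
  inversions and zeros to the right of each letter. Hence two moves out of the same rook have a meet, given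
  by the braid-type relation between the two generators, and the criterion of Bjorner, Edelman and
  Ziegler yields all meets; joins follow as there is a top element. On transposed rooks,
  \<open>St\<close> erases everything up to the last zero. It is a monotone interior operator on the lattice, and
  moving all zeros to the front is a monotone closure operator with the same image, so this
  image is closed under joins and meets.

  That a word is determined up to congruence by the image of the identity rook is an
  induction down from the identity: two last steps into the same rook are joined above it
  by one of the defining relations.\<close>

section \<open>Reachability of rooks\<close>

text \<open>Because \<open>rook0_monoid n\<close> is given by a presentation, nothing about
  \<open>rook_elt\<close> or about left ideals can be read off rooks until the action on the
  identity rook is known to be faithful. Two obstacles arise in that word problem. A word may
  contain letters that fix the current rook, and they have to be absorbed before the last steps of
  two words can be compared. The generator 0 forgets which letter it erased, so two last steps by it
  may come from different rooks. Transposition becomes algebraic through corner sums: a generator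
  changes a single row, by an expression in maxima and truncated decrements, and such an operation
  commutes with the same kind of operation on columns. Two operators are used at the end because an
  interior operator controls only joins, and a closure operator only meets. That the stellar monoid
  carries the restricted order is due to \<open>stell0_map\<close> moving elements down: St(m y)
  \<le> m y \<le> y.\<close>

fun precedes :: "'a list \<Rightarrow> 'a \<Rightarrow> 'a \<Rightarrow> bool" where
  "precedes [] b a \<longleftrightarrow> False"
| "precedes (x # xs) b a \<longleftrightarrow> (x = b \<and> a \<in> set xs) \<or> precedes xs b a"

text \<open>Inversions between nonzero letters are recorded pair by pair, but zeros are
  indistinguishable, so a letter can only be credited with the number of zeros to its right.\<close>

fun zeros_after :: "nat list \<Rightarrow> nat \<Rightarrow> nat" where
  "zeros_after [] b = 0"
| "zeros_after (x # xs) b = (if x = b then count_list xs 0 else zeros_after xs b)"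

lemma precedes_append:
  "precedes (xs @ ys) b a \<longleftrightarrow> precedes xs b a \<or> precedes ys b a \<or> (b \<in> set xs \<and> a \<in> set ys)"
  by (induction xs) auto

lemma zeros_after_append:
  "zeros_after (xs @ ys) b =
    (if b \<in> set xs then zeros_after xs b + count_list ys 0 else zeros_after ys b)"
  by (induction xs) auto

lemma precedes_set: "precedes xs b a \<Longrightarrow> a \<in> set xs \<and> b \<in> set xs"
  by (induction xs) auto

text \<open>Going down from \<open>r\<close> to \<open>z\<close>, letters only disappear, and a surviving letter keeps its
  inversions and the zeros to its right.\<close>

definition rook_le :: "nat list \<Rightarrow> nat list \<Rightarrow> bool" where
  "rook_le z r \<longleftrightarrow> (\<forall>b\<in>set z. b \<noteq> 0 \<longrightarrow> b \<in> set r
     \<and> (\<forall>a. 0 < a \<and> a < b \<and> precedes r b a \<longrightarrow> precedes z b a)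
     \<and> zeros_after r b \<le> zeros_after z b)"

lemma rook_le_refl: "rook_le r r"
  by (simp add: rook_le_def)

text \<open>The rook condition without length and bound, so that it splits over
  concatenation.\<close>

definition distinct_nz :: "nat list \<Rightarrow> bool" where
  "distinct_nz r \<longleftrightarrow> distinct (filter (\<lambda>x. x \<noteq> 0) r)"

lemma distinct_nz_simps [simp]:
  "distinct_nz []"
  "distinct_nz (x # xs) \<longleftrightarrow> (x = 0 \<or> x \<notin> set xs) \<and> distinct_nz xs"
  "distinct_nz (xs @ ys) \<longleftrightarrow> distinct_nz xs \<and> distinct_nz ys \<and> set xs \<inter> set ys \<subseteq> {0}"
  by (auto simp: distinct_nz_def)

lemma rooks_iff: "r \<in> rooks n \<longleftrightarrow> length r = n \<and> set r \<subseteq> {0..n} \<and> distinct_nz r"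
  by (simp add: rooks_def distinct_nz_def)

lemma gen_act_split:
  "gen_act (xs @ a # b # ys) (Suc (length xs)) = (if a < b then xs @ b # a # ys else xs @ a # b # ys)"
  by (simp add: gen_act_def nth_append list_update_append)

lemma gen_act_zero: "gen_act (x # xs) 0 = 0 # xs"
  by (simp add: gen_act_def)

lemma gen_cases:
  assumes "k < length r"
  obtains (zero) x xs where "k = 0" "r = x # xs"
  | (swap) xs a b ys where "k = Suc (length xs)" "r = xs @ a # b # ys"
proof (cases k)
  case 0
  with assms zero show ?thesis by (cases r) auto
next
  case (Suc j)
  with assms have "r = take j r @ r ! j # r ! Suc j # drop (Suc (Suc j)) r"
    by (metis Cons_nth_drop_Suc Suc_lessD append_take_drop_id)
  with Suc assms swap show ?thesis by (metis Suc_lessD length_take min.absorb4)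
qed

lemma set_gen_act: "k < length r \<Longrightarrow> set (gen_act r k) \<subseteq> insert 0 (set r)"
  by (erule gen_cases) (auto simp: gen_act_split gen_act_zero)

lemma distinct_nz_gen_act: "k < length r \<Longrightarrow> distinct_nz r \<Longrightarrow> distinct_nz (gen_act r k)"
  by (erule gen_cases) (auto simp: gen_act_split gen_act_zero)

lemma gen_act_rooks: "r \<in> rooks n \<Longrightarrow> k < n \<Longrightarrow> gen_act r k \<in> rooks n"
  using set_gen_act[of k r] distinct_nz_gen_act[of k r] by (auto simp: rooks_iff)

lemma word_act_rooks: "r \<in> rooks n \<Longrightarrow> w \<in> lists {..<n} \<Longrightarrow> word_act r w \<in> rooks n"
  unfolding word_act_def by (induction w arbitrary: r) (auto simp: gen_act_rooks)

text \<open>A move only deletes a letter, creates an inversion or brings a zero to the right of a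
  letter. Each of these makes the conditions on z more demanding, so they pull back to r.\<close>

lemma rook_le_of_gen_act:
  assumes "k < length r" "distinct_nz r" "rook_le z (gen_act r k)"
  shows "rook_le z r"
  using assms(1)
proof (cases rule: gen_cases)
  case (zero x xs)
  then show ?thesis using assms
    by (auto simp: rook_le_def gen_act_zero dest: precedes_set)
next
  case (swap xs a b ys)
  show ?thesis
  proof (cases "a < b")
    case True
    show ?thesis
      unfolding rook_le_def
    proof (intro ballI impI conjI allI)
      fix c assume c: "c \<in> set z" "c \<noteq> 0"
      have *: "c \<in> set (xs @ b # a # ys)"
        "\<And>d. 0 < d \<and> d < c \<and> precedes (xs @ b # a # ys) c d \<longrightarrow> precedes z c d"
        "zeros_after (xs @ b # a # ys) c \<le> zeros_after z c"
        using assms(3) c True unfolding rook_le_def swap gen_act_split by auto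
      show "c \<in> set r" using * swap by auto
      show "precedes z c d" if "0 < d \<and> d < c \<and> precedes r c d" for d
        using *(2)[of d] that True unfolding swap by (auto simp: precedes_append)
      show "zeros_after r c \<le> zeros_after z c"
        using *(1,3) True assms(2) c(2) unfolding swap by (auto simp: zeros_after_append split: if_splits)
    qed
  qed (use assms swap gen_act_split in auto)
qed

section \<open>Reachability by moves\<close>

definition reach :: "nat list \<Rightarrow> nat list \<Rightarrow> bool" where
  "reach r z \<longleftrightarrow> (\<exists>w\<in>lists {..<length r}. word_act r w = z)"

lemma reach_refl: "reach r r"
  unfolding reach_def by (rule bexI[of _ "[]"]) (auto simp: word_act_def)

lemma reach_trans: "reach r s \<Longrightarrow> reach s z \<Longrightarrow> reach r z"
  unfolding reach_def by (metis append_in_lists_conv length_word_act word_act_append)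

lemma reach_gen_act: "k < length r \<Longrightarrow> reach r (gen_act r k)"
  unfolding reach_def by (rule bexI[of _ "[k]"]) (auto simp: word_act_def)

lemma reach_induct [consumes 1, case_names refl step]:
  assumes "reach r z" and "P z"
    and step: "\<And>s k. k < length s \<Longrightarrow> length s = length r \<Longrightarrow> reach r s
      \<Longrightarrow> reach (gen_act s k) z \<Longrightarrow> P (gen_act s k) \<Longrightarrow> P s"
  shows "P r"
proof -
  have "P s" if "w \<in> lists {..<length r}" "reach r s" "length s = length r" "word_act s w = z" for s w
    using that
  proof (induction w arbitrary: s)
    case Nil
    then show ?case using assms(2) by (simp add: word_act_def)
  next
    case (Cons k w)
    have k: "k < length s" and w: "w \<in> lists {..<length r}"
      using Cons.prems Cons.hyps by auto
    have z: "word_act (gen_act s k) w = z"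
      using Cons.prems by (simp add: word_act_def)
    have "reach (gen_act s k) z"
      unfolding reach_def using w z Cons.prems by auto
    moreover have "reach r (gen_act s k)"
      using \<open>reach r s\<close> reach_gen_act[OF k] by (rule reach_trans)
    then have "P (gen_act s k)"
      using Cons.IH w z Cons.prems by simp
    ultimately show ?case using step k Cons.prems by blast
  qed
  then show ?thesis using assms(1) reach_refl unfolding reach_def by blast
qed

lemma reach_distinct_nz: "reach r z \<Longrightarrow> distinct_nz r \<Longrightarrow> distinct_nz z"
  by (induction rule: reach_induct) (auto simp: distinct_nz_gen_act)

lemma rook_le_of_reach: "reach r z \<Longrightarrow> distinct_nz r \<Longrightarrow> rook_le z r"
  by (induction rule: reach_induct) (auto simp: rook_le_refl distinct_nz_gen_act intro: rook_le_of_gen_act)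

text \<open>Nothing stands before the front letter, so erasing it changes neither inversions nor
  zero counts of the other letters; only its own presence in z matters.\<close>

lemma rook_le_zero_move_iff:
  assumes "distinct_nz (x # xs)" "rook_le z (x # xs)"
  shows "rook_le z (0 # xs) \<longleftrightarrow> x = 0 \<or> x \<notin> set z"
proof (cases "x = 0 \<or> x \<notin> set z")
  case True
  have "rook_le z (0 # xs)"
    unfolding rook_le_def
  proof (intro ballI impI)
    fix b assume b: "b \<in> set z" "b \<noteq> 0"
    then show "b \<in> set (0 # xs) \<and> (\<forall>a. 0 < a \<and> a < b \<and> precedes (0 # xs) b a \<longrightarrow> precedes z b a) \<and>
        zeros_after (0 # xs) b \<le> zeros_after z b"
      using bspec[OF assms(2)[unfolded rook_le_def], OF b(1)] True by (auto split: if_splits)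
  qed
  with True show ?thesis by simp
next
  case False
  then have "x \<notin> set (0 # xs)" using assms(1) by simp
  then have "\<not> rook_le z (0 # xs)" using False unfolding rook_le_def by blast
  with False show ?thesis by simp
qed

text \<open>Only the relative order of a and b changes. If a is nonzero this is one new inversion.
  If a = 0, the letter b has \<open>count_list ys 0\<close> zeros on its right before the swap and
  one more after it, whence the strict inequality.\<close>

lemma rook_le_swap_iff:
  assumes "distinct_nz (xs @ a # b # ys)" "rook_le z (xs @ a # b # ys)" "a < b"
  shows "rook_le z (xs @ b # a # ys) \<longleftrightarrow>
    b \<notin> set z \<or> (if a = 0 then zeros_after z b > count_list ys 0 else precedes z b a)"
proof
  assume "rook_le z (xs @ b # a # ys)"
  then have "b \<in> set z \<longrightarrow> (\<forall>a'. 0 < a' \<and> a' < b \<and> precedes (xs @ b # a # ys) b a' \<longrightarrow> precedes z b a')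
    \<and> zeros_after (xs @ b # a # ys) b \<le> zeros_after z b"
    using assms(3) by (auto simp: rook_le_def)
  moreover have "precedes (xs @ b # a # ys) b a" by (auto simp: precedes_append)
  moreover have "b \<notin> set xs" using assms by auto
  ultimately show "b \<notin> set z \<or> (if a = 0 then zeros_after z b > count_list ys 0 else precedes z b a)"
    using assms(3) by (auto simp: zeros_after_append)
next
  assume *: "b \<notin> set z \<or> (if a = 0 then zeros_after z b > count_list ys 0 else precedes z b a)"
  show "rook_le z (xs @ b # a # ys)"
    unfolding rook_le_def
  proof (intro ballI impI conjI allI)
    fix c assume c: "c \<in> set z" "c \<noteq> 0"
    have h: "c \<in> set (xs @ a # b # ys)"
      "\<And>d. 0 < d \<and> d < c \<and> precedes (xs @ a # b # ys) c d \<longrightarrow> precedes z c d"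
      "zeros_after (xs @ a # b # ys) c \<le> zeros_after z c"
      using assms(2) c unfolding rook_le_def by auto
    show "c \<in> set (xs @ b # a # ys)" using h by auto
    show "precedes z c d" if "0 < d \<and> d < c \<and> precedes (xs @ b # a # ys) c d" for d
      using h(2)[of d] that assms(1,3) c * by (auto simp: precedes_append split: if_splits)
    show "zeros_after (xs @ b # a # ys) c \<le> zeros_after z c"
      using h(1,3) assms(1,3) c * by (auto simp: zeros_after_append split: if_splits)
  qed
qed

section \<open>Sufficiency of the comparison\<close>

lemma length_eq_count_list_zero: "distinct_nz r \<Longrightarrow> length r = count_list r 0 + card (set r - {0})"
proof (induction r)
  case (Cons x r)
  then show ?case by (cases "x = 0") (auto simp: insert_Diff_if)
qed simp

lemma count_list_zero_eq:
  assumes "distinct_nz r" "distinct_nz z" "length r = length z" "set r - {0} = set z - {0}"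
  shows "count_list r 0 = count_list z 0"
proof -
  show ?thesis
    using length_eq_count_list_zero[OF assms(1)] length_eq_count_list_zero[OF assms(2)] assms(3,4) by simp
qed

text \<open>The move acts on the first letter c of r that z lacks. At the front it is erased.
  Otherwise its left neighbour is smaller: it is 0 or a letter of z, and a larger letter of z would
  force c into z as part of an inversion. Passing c over this neighbour costs nothing because c is
  absent from z.\<close>

lemma ex_move_support:
  assumes "distinct_nz r" "rook_le z r" "c \<in> set r" "c \<noteq> 0" "c \<notin> set z"
  obtains k where "k < length r" "gen_act r k \<noteq> r" "rook_le z (gen_act r k)"
proof -
  from assms(3-5) obtain p t c where r: "r = p @ c # t" and c: "c \<noteq> 0" "c \<notin> set z"
    and p: "\<forall>x\<in>set p. x = 0 \<or> x \<in> set z"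
    using split_list_first_prop[of r "\<lambda>c. c \<noteq> 0 \<and> c \<notin> set z"] by blast
  show ?thesis
  proof (cases p rule: rev_cases)
    case Nil
    then show ?thesis using that[of 0] rook_le_zero_move_iff[of c t z] assms r c
      by (auto simp: gen_act_zero)
  next
    case (snoc p' x)
    have r': "r = p' @ x # c # t" using r snoc by simp
    have "x < c"
    proof (rule ccontr)
      assume "\<not> x < c"
      with c p snoc have "x > c" "x \<in> set z" by (auto, metis linorder_less_linear)
      moreover have "precedes r x c" by (auto simp: r' precedes_append)
      ultimately have "precedes z x c" using assms(2) c(1) by (auto simp: rook_le_def)
      with c show False by (auto dest: precedes_set)
    qed
    then show ?thesis
      using that[of "Suc (length p')"] rook_le_swap_iff[of p' x c t z] assms c
      unfolding r' by (auto simp: gen_act_split)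
  qed
qed

lemma first_difference:
  assumes "length r = length z" "r \<noteq> z"
  obtains p a r' c z' where "r = p @ a # r'" "z = p @ c # z'" "a \<noteq> c"
  using assms
proof (induction r z arbitrary: thesis rule: list_induct2)
  case (Cons x xs y ys)
  show ?case
  proof (cases "x = y")
    case True
    with Cons.prems(2) have "xs \<noteq> ys" by simp
    then obtain p a r' c z' where "xs = p @ a # r'" "ys = p @ c # z'" "a \<noteq> c"
      using Cons.IH by blast
    then show ?thesis using True Cons.prems(1)[of "x # p" a r' c z'] by auto
  next
    case False
    then show ?thesis using Cons.prems(1)[of "[]" x xs y ys] by auto
  qed
qed auto

text \<open>With equal supports, r is compared with z at the first place where they differ. The
  letter c that z has there stands further right in r, and it can be moved one place to the left:
  apart from the common prefix, z has everything after c.\<close>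

lemma ex_move:
  assumes "distinct_nz r" "distinct_nz z" "length r = length z" "rook_le z r" "r \<noteq> z"
  obtains k where "k < length r" "gen_act r k \<noteq> r" "rook_le z (gen_act r k)"
proof (cases "set r - {0} \<subseteq> set z")
  case False
  then show ?thesis using ex_move_support[OF assms(1,4)] that by blast
next
  case True
  with assms(4) have supp: "set r - {0} = set z - {0}" by (auto simp: rook_le_def)
  have zc: "count_list r 0 = count_list z 0"
    using count_list_zero_eq assms supp by blast
  obtain p a r' c z' where r: "r = p @ a # r'" and z: "z = p @ c # z'" and ac: "a \<noteq> c"
    using first_difference assms(3,5) by blast
  have zc': "count_list (a # r') 0 = count_list (c # z') 0"
    using zc by (simp add: r z)
  show ?thesis
  proof (cases "c = 0")
    \<comment> \<open>Impossible: all zeros of \<open>r'\<close> follow a in r, so at least as many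
      follow a in \<open>z'\<close>. But z has one zero more, namely c itself, than
      \<open>z'\<close>, while both tails contain equally many.\<close>
    case True
    then have "a \<noteq> 0" using ac by simp
    then have "a \<in> set z'" "a \<notin> set p" using supp ac assms(1) by (auto simp: r z)
    then have "zeros_after r a \<le> zeros_after z a"
      using assms(4) \<open>a \<noteq> 0\<close> by (auto simp: rook_le_def z)
    then have "count_list r' 0 \<le> zeros_after z' a"
      using \<open>a \<notin> set p\<close> ac by (auto simp: r z zeros_after_append)
    moreover have "zeros_after xs a \<le> count_list xs 0" for xs
      by (induction xs) auto
    ultimately have "count_list r' 0 \<le> count_list z' 0"
      by (meson order_trans)
    with zc' True \<open>a \<noteq> 0\<close> show ?thesis by simp
  next
    case c0: False
    then have "c \<in> set (a # r')" "c \<notin> set p" using supp assms(2) by (auto simp: r z)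
    then obtain s t where "r' = s @ c # t"
      using ac by (metis set_ConsD split_list)
    then obtain s' x where s': "a # r' = s' @ x # c # t"
      by (metis append.assoc append_Cons append_Nil rev_exhaust list.distinct(1) )
    then have r': "r = (p @ s') @ x # c # t" by (simp add: r)
    have xp: "x = 0 \<or> x \<notin> set p" using assms(1) by (auto simp: r')
    have "x \<noteq> c" using assms(1) c0 by (auto simp: r')
    \<comment> \<open>A nonzero x does not occur in p, so in z it can only stand behind c.\<close>
    have xz: "precedes z c x" if "x \<noteq> 0"
    proof -
      have "x \<in> set z" using that supp by (auto simp: r')
      with xp that \<open>x \<noteq> c\<close> have "x \<in> set z'" by (auto simp: z)
      then show ?thesis by (auto simp: z precedes_append)
    qed
    have "x < c"
    proof (rule ccontr)
      assume "\<not> x < c"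
      then have xc: "x > c" using \<open>x \<noteq> c\<close> by simp
      have "precedes r x c" by (auto simp: r' precedes_append)
      moreover have "x \<in> set z" using xc xz by (auto dest: precedes_set)
      ultimately have "precedes z x c" using assms(4) xc c0 by (auto simp: rook_le_def)
      then show False using xp xc assms(2) c0 \<open>c \<notin> set p\<close>
        by (auto simp: z precedes_append dest: precedes_set)
    qed
    \<comment> \<open>All zeros of the tail of z lie behind c, and their number is that of the tail
      of r, which contains x = 0 besides the zeros of t.\<close>
    moreover have "zeros_after z c > count_list t 0" if "x = 0"
    proof -
      have "zeros_after z c = count_list (c # z') 0"
        using \<open>c \<notin> set p\<close> c0 by (simp add: z zeros_after_append)
      also have "\<dots> > count_list t 0"
        unfolding zc'[symmetric] s' using that by simp
      finally show ?thesis .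
    qed
    ultimately have "rook_le z ((p @ s') @ c # x # t)"
      using rook_le_swap_iff[of "p @ s'" x c t z] assms(1,4) xz unfolding r' by auto
    with \<open>x < c\<close> show ?thesis
      using that[of "Suc (length (p @ s'))"] gen_act_split[of "p @ s'" x c t] unfolding r' by auto
  qed
qed

text \<open>Weighting letters by their position makes an exchange of neighbours a < b cost exactly b
  - a, and erasing the front letter cost that letter; hence every proper move goes strictly
  down.\<close>

definition rook_height :: "nat list \<Rightarrow> nat" where
  "rook_height r = (\<Sum>i<length r. Suc i * r ! i)"

lemma rook_height_snoc: "rook_height (xs @ [a]) = rook_height xs + Suc (length xs) * a"
  by (simp add: rook_height_def nth_append)

lemma rook_height_append:
  "rook_height (xs @ ys) = rook_height xs + length xs * sum_list ys + rook_height ys"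
proof (induction ys rule: rev_induct)
  case Nil
  then show ?case by (simp add: rook_height_def)
next
  case (snoc y ys)
  then show ?case
    unfolding append_assoc[symmetric] rook_height_snoc by (simp add: algebra_simps)
qed

lemma rook_height_Cons: "rook_height (x # xs) = x + sum_list xs + rook_height xs"
  using rook_height_append[of "[x]" xs] by (simp add: rook_height_def)

lemma rook_height_gen_act:
  assumes "k < length r" "gen_act r k \<noteq> r"
  shows "rook_height (gen_act r k) < rook_height r"
  using assms(1)
proof (cases rule: gen_cases)
  case (swap xs a b ys)
  then have "a < b" using assms(2) by (auto simp: gen_act_split split: if_splits)
  then show ?thesis
    by (simp add: swap gen_act_split rook_height_append rook_height_Cons algebra_simps)
qed (use assms in \<open>auto simp: gen_act_zero rook_height_Cons\<close>)

lemma reach_height: "reach r z \<Longrightarrow> r = z \<or> rook_height z < rook_height r"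
  by (induction rule: reach_induct) (metis rook_height_gen_act order.strict_trans)+

lemma reach_antisym: "reach r z \<Longrightarrow> reach z r \<Longrightarrow> r = z"
  using reach_height[of r z] reach_height[of z r] by auto

lemma reach_of_rook_le:
  assumes "distinct_nz r" "distinct_nz z" "length r = length z" "rook_le z r"
  shows "reach r z"
  using assms
proof (induction "rook_height r" arbitrary: r rule: less_induct)
  case less
  show ?case
  proof (cases "r = z")
    case False
    with less.prems obtain k where k: "k < length r" "gen_act r k \<noteq> r" "rook_le z (gen_act r k)"
      using ex_move by metis
    then have "reach (gen_act r k) z"
      using less.prems rook_height_gen_act distinct_nz_gen_act by (intro less.hyps) auto
    then show ?thesis using reach_gen_act reach_trans k(1) by blast
  qed (simp add: reach_refl)
qed

lemma reach_iff:
  "distinct_nz r \<Longrightarrow> distinct_nz z \<Longrightarrow> length r = length z \<Longrightarrow> reach r z \<longleftrightarrow> rook_le z r"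
  using reach_of_rook_le rook_le_of_reach by blast

section \<open>Meets of rooks\<close>

lemma precedes_trans:
  "distinct_nz z \<Longrightarrow> b \<noteq> 0 \<Longrightarrow> precedes z c b \<Longrightarrow> precedes z b a \<Longrightarrow> precedes z c a"
  by (induction z) (auto dest: precedes_set)

lemma zeros_after_le_count: "zeros_after z b \<le> count_list z 0"
  by (induction z) auto

text \<open>The counterpart of \<open>precedes_trans\<close> for zeros. In the braid case the
  smallest of the three letters may be 0, and then transitivity has to be expressed by
  counts.\<close>

lemma zeros_after_antimono:
  "distinct_nz z \<Longrightarrow> b \<noteq> 0 \<Longrightarrow> precedes z c b \<Longrightarrow> zeros_after z b \<le> zeros_after z c"
  by (induction z) (auto simp: zeros_after_le_count dest: precedes_set)

text \<open>By \<open>rook_le_swap_iff\<close> the condition for the move l involves only the two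
  exchanged letters and the zeros behind them, whereas the move k acts entirely in the prefix
  xs.\<close>

lemma rook_le_gen_act_append:
  assumes "distinct_nz r" "rook_le z r" "rook_le z (gen_act r k)" "rook_le z (gen_act r l)"
    and "Suc k < l" "l < length r"
  shows "rook_le z (gen_act (gen_act r k) l)"
proof -
  obtain xs a b ys where r: "r = xs @ a # b # ys" and l: "l = Suc (length xs)"
    using gen_cases[OF assms(6)] assms(5) by (metis less_nat_zero_code)
  have kx: "k < length xs" using assms(5) l by simp
  have rk: "gen_act r k = gen_act xs k @ a # b # ys"
    using kx by (auto simp: r gen_act_def nth_append list_update_append)
  show ?thesis
  proof (cases "a < b")
    case True
    have "distinct_nz (gen_act xs k @ a # b # ys)"
      using distinct_nz_gen_act[OF _ assms(1), of k] kx rk by (simp add: r)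
    moreover have "gen_act r l = xs @ b # a # ys"
      using gen_act_split[of xs a b ys] True by (simp add: r l)
    ultimately show ?thesis
      using rook_le_swap_iff[of xs a b ys z] rook_le_swap_iff[of "gen_act xs k" a b ys z] assms True
        gen_act_split[of "gen_act xs k" a b ys]
      unfolding rk unfolding l r by auto
  next
    case False
    then show ?thesis using assms(3) rk gen_act_split[of "gen_act xs k" a b ys] by (simp add: l)
  qed
qed

text \<open>For a < b < c the hypotheses say that, as far as present in z, b has passed a and c has
  passed b. By transitivity c has passed a, so all three exchanges leading to c b a are
  allowed.\<close>

lemma rook_le_braid:
  assumes "distinct_nz r" "distinct_nz z" "rook_le z r"
    and "rook_le z (gen_act r k)" "rook_le z (gen_act r (Suc k))"
    and "0 < k" "Suc k < length r" "gen_act r k \<noteq> r" "gen_act r (Suc k) \<noteq> r"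
  shows "rook_le z (word_act r [k, Suc k, k])"
proof -
  obtain xs a d ys' where r': "r = xs @ a # d # ys'" and k: "k = Suc (length xs)"
    using gen_cases[of k r] assms(6,7) by (metis Suc_lessD less_numeral_extra(3))
  with assms(7) obtain b c ys where r: "r = xs @ a # b # c # ys"
    by (cases ys') auto
  have ab: "a < b" using assms(8) gen_act_split[of xs a b "c # ys"] by (auto simp: r k split: if_splits)
  have bc: "b < c" using assms(9) gen_act_split[of "xs @ [a]" b c ys] by (auto simp: r k split: if_splits)
  have w: "word_act r [k, Suc k, k] = xs @ c # b # a # ys"
    using gen_act_split[of xs a b "c # ys"] gen_act_split[of "xs @ [b]" a c ys]
      gen_act_split[of xs b c "a # ys"] ab bc by (simp add: word_act_def r k)
  have 1: "gen_act r k = xs @ b # a # c # ys"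
    using gen_act_split[of xs a b "c # ys"] ab by (simp add: r k)
  have 2: "gen_act r (Suc k) = xs @ a # c # b # ys"
    using gen_act_split[of "xs @ [a]" b c ys] bc by (simp add: r k)
  have d: "distinct_nz (xs @ b # a # c # ys)" "distinct_nz (xs @ b # c # a # ys)"
    using assms(1) ab bc by (auto simp: r)
  have P: "b \<notin> set z \<or> (if a = 0 then zeros_after z b > count_list (c # ys) 0 else precedes z b a)"
    using rook_le_swap_iff[of xs a b "c # ys" z] assms(1,3,4) ab 1 by (simp add: r)
  have Q: "c \<notin> set z \<or> precedes z c b"
    using rook_le_swap_iff[of "xs @ [a]" b c ys z] assms(1,3,5) ab bc 2 by (simp add: r)
  have "c \<notin> set z \<or> (if a = 0 then zeros_after z c > count_list ys 0 else precedes z c a)"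
  proof (cases "c \<in> set z")
    case True
    then have cb: "precedes z c b" using Q by simp
    then have "b \<in> set z" by (auto dest: precedes_set)
    then show ?thesis
      using P bc ab cb assms(2) precedes_trans[of z b c a] zeros_after_antimono[of z b c]
      by (auto split: if_splits)
  qed simp
  then have "rook_le z (xs @ b # c # a # ys)"
    using rook_le_swap_iff[of "xs @ [b]" a c ys z] d(1) assms(4) ab bc unfolding 1 by auto
  then show ?thesis
    using rook_le_swap_iff[of xs b c "a # ys" z] d(2) Q ab bc unfolding w by auto
qed

text \<open>Lying below the move 0, z lacks a. Lying below the move 1 it would need b before a, so
  it lacks b as well, and both letters may be erased.\<close>

lemma rook_le_zero_one:
  assumes "distinct_nz r" "rook_le z r" "rook_le z (gen_act r 0)" "rook_le z (gen_act r (Suc 0))"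
    and "Suc 0 < length r" "gen_act r 0 \<noteq> r" "gen_act r (Suc 0) \<noteq> r"
  shows "rook_le z (word_act r [0, Suc 0, 0])"
proof -
  obtain a b ys where r: "r = a # b # ys"
    using assms(5) by (cases r; cases "tl r") auto
  have a: "a \<noteq> 0" using assms(6) by (simp add: r gen_act_zero)
  have ab: "a < b" using assms(7) gen_act_split[of "[]" a b ys] by (auto simp: r split: if_splits)
  have "a \<notin> set z"
    using rook_le_zero_move_iff[of a "b # ys" z] assms(1-3) a by (auto simp: r gen_act_zero)
  moreover have "b \<notin> set z \<or> precedes z b a"
    using rook_le_swap_iff[of "[]" a b ys z] gen_act_split[of "[]" a b ys] assms(1,2,4) a ab
    by (auto simp: r)
  ultimately have nin: "a \<notin> set z" "b \<notin> set z" by (auto dest: precedes_set)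
  have w: "word_act r [0, Suc 0, 0] = 0 # 0 # ys"
    using gen_act_split[of "[]" 0 b ys] ab by (simp add: word_act_def r gen_act_zero)
  have "rook_le z (0 # b # ys)"
    using assms(3) by (simp add: r gen_act_zero)
  then have "rook_le z (b # 0 # ys)"
    using rook_le_swap_iff[of "[]" 0 b ys z] assms(1) nin ab by (auto simp: r)
  then show ?thesis
    unfolding w using rook_le_zero_move_iff[of b "0 # ys" z] assms(1) nin ab by (auto simp: r)
qed

section \<open>Meets for reachability\<close>

lemma reach_length: "reach r z \<Longrightarrow> length z = length r"
  by (auto simp: reach_def)

lemma reach_word_act: "w \<in> lists {..<length r} \<Longrightarrow> reach r (word_act r w)"
  by (auto simp: reach_def)

definition is_meet :: "nat list \<Rightarrow> nat list \<Rightarrow> nat list \<Rightarrow> bool" where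
  "is_meet x y m \<longleftrightarrow> reach x m \<and> reach y m \<and> (\<forall>z. reach x z \<and> reach y z \<longrightarrow> reach m z)"

lemma is_meet_commute: "is_meet x y m \<longleftrightarrow> is_meet y x m"
  by (auto simp: is_meet_def)

lemma ex_meet_gen_act:
  assumes "distinct_nz r" "k < length r" "l < length r" "gen_act r k \<noteq> r" "gen_act r l \<noteq> r"
  shows "\<exists>m. is_meet (gen_act r k) (gen_act r l) m"
  using assms
proof (induction k l rule: linorder_wlog)
  case (sym k l)
  then show ?case using is_meet_commute by blast
next
  case (le k l)
  have dk: "distinct_nz (gen_act r k)" and dl: "distinct_nz (gen_act r l)"
    using le by (simp_all add: distinct_nz_gen_act)
  have z: "distinct_nz z" "length z = length r" "rook_le z r" "rook_le z (gen_act r k)" "rook_le z (gen_act r l)"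
    if "reach (gen_act r k) z" "reach (gen_act r l) z" for z
    using that le.prems dk dl reach_distinct_nz reach_length rook_le_of_reach
      rook_le_of_gen_act[of k r z] by fastforce+
  \<comment> \<open>Shared by the three cases of distinct generators: \<open>eq\<close> is the
    defining relation between k and l and gives a common lower bound, and \<open>le'\<close> makes
    it the greatest one.\<close>
  have meet: "is_meet (gen_act r k) (gen_act r l) (word_act r (k # u))"
    if u: "set u \<subseteq> {k, l}" and v: "set v \<subseteq> {k, l}" and eq: "word_act r (k # u) = word_act r (l # v)"
      and le': "\<And>z. distinct_nz z \<Longrightarrow> rook_le z r \<Longrightarrow> rook_le z (gen_act r k) \<Longrightarrow> rook_le z (gen_act r l)
        \<Longrightarrow> rook_le z (word_act r (k # u))" for u v
  proof -
    have uv: "u \<in> lists {..<length r}" "v \<in> lists {..<length r}"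
      using u v le.prems by auto
    have "reach (gen_act r k) (word_act r (k # u))"
      using reach_word_act[of u "gen_act r k"] uv by (simp add: word_act_def)
    moreover have "reach (gen_act r l) (word_act r (k # u))"
      unfolding eq using reach_word_act[of v "gen_act r l"] uv by (simp add: word_act_def)
    moreover have "distinct_nz (word_act r (k # u))"
      using calculation(1) dk reach_distinct_nz by blast
    then have "reach (word_act r (k # u)) z" if "reach (gen_act r k) z" "reach (gen_act r l) z" for z
      using z[OF that] le' by (intro reach_of_rook_le) auto
    ultimately show ?thesis by (auto simp: is_meet_def)
  qed
  consider "k = l" | "Suc k = l" "k = 0" | "Suc k = l" "0 < k" | "Suc k < l"
    using le.hyps by linarith
  then show ?case
  proof cases
    case 1
    then show ?thesis using reach_refl by (auto simp: is_meet_def)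
  next
    case 2
    have "word_act r [0, Suc 0, 0] = word_act r [Suc 0, 0, Suc 0, 0]"
      using word_act_zero(1)[of r] le.prems 2 by simp
    then show ?thesis
      using meet[of "[Suc 0, 0]" "[0, Suc 0, 0]"] rook_le_zero_one[of r] le.prems 2 by auto
  next
    case 3
    have "word_act r [k, Suc k, k] = word_act r [Suc k, k, Suc k]"
      using word_act_braid[of k r] le.prems 3 by simp
    then show ?thesis
      using meet[of "[Suc k, k]" "[k, Suc k]"] rook_le_braid[of r _ k] le.prems 3 by auto
  next
    case 4
    have "word_act r [k, l] = word_act r [l, k]"
      using word_act_comm[of k r l] le.prems 4 by simp
    then show ?thesis
      using meet[of "[l]" "[k]"] rook_le_gen_act_append[of r _ k l] le.prems 4 by (auto simp: word_act_def)
  qed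
qed

lemma reach_proper_step:
  assumes "reach r z" "r \<noteq> z"
  obtains k where "k < length r" "gen_act r k \<noteq> r" "reach (gen_act r k) z"
proof -
  have "r \<noteq> z \<longrightarrow> (\<exists>k<length r. gen_act r k \<noteq> r \<and> reach (gen_act r k) z)"
    using assms(1) by (induction rule: reach_induct) (simp, metis)
  with assms(2) that show ?thesis by blast
qed

text \<open>Bjorner--Edelman--Ziegler: it suffices to have meets of any two elements covered by a common one.\<close>

lemma ex_meet:
  assumes "distinct_nz r" "reach r x" "reach r y"
  shows "\<exists>m. is_meet x y m"
  using assms
proof (induction "rook_height r" arbitrary: r x y rule: less_induct)
  case less
  show ?case
  proof (cases "r = x \<or> r = y")
    case True
    then have "is_meet x y y \<or> is_meet x y x"
      using less.prems reach_refl by (auto simp: is_meet_def)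
    then show ?thesis by blast
  next
    case False
    obtain k where k: "k < length r" "gen_act r k \<noteq> r" "reach (gen_act r k) x"
      using reach_proper_step[OF less.prems(2)] False by metis
    obtain l where l: "l < length r" "gen_act r l \<noteq> r" "reach (gen_act r l) y"
      using reach_proper_step[OF less.prems(3)] False by metis
    \<comment> \<open>Below the first move k, the rook x is met with m, giving p. Every common lower
      bound of x and y is below m and hence below p. As p is also below the move l, it can be met
      with y there.\<close>
    obtain m where m: "is_meet (gen_act r k) (gen_act r l) m"
      using ex_meet_gen_act less.prems k l by blast
    then have "reach (gen_act r k) m" by (simp add: is_meet_def)
    then obtain p where p: "is_meet x m p"
      using less.hyps[OF rook_height_gen_act[OF k(1,2)] distinct_nz_gen_act[OF k(1) less.prems(1)] k(3)]
      by blast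
    then have "reach (gen_act r l) p"
      using m reach_trans by (auto simp: is_meet_def)
    then obtain g where g: "is_meet p y g"
      using less.hyps[OF rook_height_gen_act[OF l(1,2)] distinct_nz_gen_act[OF l(1) less.prems(1)]] l(3)
      by blast
    have "is_meet x y g"
      using k(3) l(3) m p g reach_trans unfolding is_meet_def by meson
    then show ?thesis by blast
  qed
qed

section \<open>Words and rooks\<close>

abbreviation rook_cong :: "nat \<Rightarrow> nat list \<Rightarrow> nat list \<Rightarrow> bool" where
  "rook_cong n u v \<equiv> (u, v) \<in> word_cong {..<n} (rook_rels n)"

lemma rook_cong_context:
  "rook_cong n u v \<Longrightarrow> p \<in> lists {..<n} \<Longrightarrow> q \<in> lists {..<n} \<Longrightarrow> rook_cong n (p @ u @ q) (p @ v @ q)"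
  by (intro word_cong.append word_cong.refl)

lemma rook_cong_idem: "i < n \<Longrightarrow> rook_cong n [i, i] [i]"
  by (rule word_cong.base) (auto simp: rook_rels_def)

lemma rook_cong_braid: "0 < i \<Longrightarrow> Suc i < n \<Longrightarrow> rook_cong n [i, Suc i, i] [Suc i, i, Suc i]"
  by (rule word_cong.base) (auto simp: rook_rels_def)

lemma rook_cong_zero:
  assumes "Suc 0 < n"
  shows "rook_cong n [Suc 0, 0, Suc 0, 0] [0, Suc 0, 0]"
    and "rook_cong n [0, Suc 0, 0, Suc 0] [0, Suc 0, 0]"
proof -
  show "rook_cong n [Suc 0, 0, Suc 0, 0] [0, Suc 0, 0]"
    using assms by (intro word_cong.base) (auto simp: rook_rels_def)
  have "rook_cong n [0, Suc 0, 0] [0, Suc 0, 0, Suc 0]"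
    using assms by (intro word_cong.base) (auto simp: rook_rels_def)
  then show "rook_cong n [0, Suc 0, 0, Suc 0] [0, Suc 0, 0]" by (rule word_cong.sym)
qed

lemma rook_cong_commute: "i < n \<Longrightarrow> j < n \<Longrightarrow> Suc i < j \<or> Suc j < i \<Longrightarrow> rook_cong n [i, j] [j, i]"
  by (rule word_cong.base) (auto simp: rook_rels_def)

lemma rook_cong_snoc: "rook_cong n u v \<Longrightarrow> k < n \<Longrightarrow> rook_cong n (u @ [k]) (v @ [k])"
  by (intro word_cong.append word_cong.refl) auto

lemma rook_cong_prefix: "rook_cong n u v \<Longrightarrow> p \<in> lists {..<n} \<Longrightarrow> rook_cong n (p @ u) (p @ v)"
  by (intro word_cong.append word_cong.refl)

section \<open>Words starting at the identity rook\<close>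

lemma id_rook_rooks: "id_rook n \<in> rooks n"
  by (auto simp: id_rook_def rooks_def)

lemma length_id_rook [simp]: "length (id_rook n) = n"
  by (simp add: id_rook_def)

lemma not_precedes_sorted: "sorted r \<Longrightarrow> a < b \<Longrightarrow> \<not> precedes r b a"
  by (induction r) auto

text \<open>The identity contains all letters and has no inversions and no zeros, so it imposes no
  condition.\<close>

lemma reach_id_rook:
  assumes "r \<in> rooks n"
  shows "reach (id_rook n) r"
proof (rule reach_of_rook_le)
  have "sorted (id_rook n)" by (simp add: id_rook_def del: upt_Suc)
  then have "\<not> precedes (id_rook n) b a" if "a < b" for a b
    using not_precedes_sorted that by blast
  moreover have "set (id_rook n) = {1..n}" by (auto simp: id_rook_def)
  moreover have "zeros_after (id_rook n) b = 0" for b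
    using zeros_after_le_count[of "id_rook n" b] by (simp add: id_rook_def count_list_0_iff)
  ultimately show "rook_le r (id_rook n)"
    using assms by (auto simp: rook_le_def rooks_iff)
qed (use assms id_rook_rooks in \<open>auto simp: rooks_iff\<close>)

lemma ex_word:
  assumes "r \<in> rooks n"
  obtains w where "w \<in> lists {..<n}" "word_act (id_rook n) w = r"
  using reach_id_rook[OF assms] by (auto simp: reach_def)

lemma rook_height_le_id_rook: "r \<in> rooks n \<Longrightarrow> rook_height r \<le> rook_height (id_rook n)"
  using reach_height[OF reach_id_rook] by fastforce

text \<open>An unconditional exchange. At a descent it undoes the move k, so for k > 0 it yields the
  only rook from which k leads properly to r.\<close>

definition swap_at :: "nat list \<Rightarrow> nat \<Rightarrow> nat list" where
  "swap_at r k = r[k - 1 := r ! k, k := r ! (k - 1)]"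

lemma length_swap_at [simp]: "length (swap_at r k) = length r"
  by (simp add: swap_at_def)

lemma swap_at_nth:
  "k < length r \<Longrightarrow> 0 < k \<Longrightarrow> i < length r \<Longrightarrow>
    swap_at r k ! i = (if i = k then r ! (k - 1) else if i = k - 1 then r ! k else r ! i)"
  by (auto simp: swap_at_def nth_list_update)

lemma swap_at_split: "swap_at (xs @ a # b # ys) (Suc (length xs)) = xs @ b # a # ys"
  by (simp add: swap_at_def nth_append list_update_append)

lemma swap_at_rooks:
  assumes "r \<in> rooks n" "0 < k" "k < n"
  shows "swap_at r k \<in> rooks n"
proof -
  have "k < length r" using assms by (simp add: rooks_iff)
  then show ?thesis
    by (cases rule: gen_cases) (use assms in \<open>auto simp: swap_at_split rooks_iff\<close>)
qed

lemma gen_act_swap_at: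
  assumes "0 < k" "k < length r" "r ! k < r ! (k - 1)"
  shows "gen_act (swap_at r k) k = r"
  by (rule nth_equalityI) (use assms in \<open>auto simp: gen_act_nth swap_at_nth\<close>)

lemma swap_at_neq:
  assumes "0 < k" "k < length r" "r ! k < r ! (k - 1)"
  shows "swap_at r k \<noteq> r"
  using swap_at_nth[of k r k] assms by force

lemma rook_height_swap_at:
  assumes "0 < k" "k < length r" "r ! k < r ! (k - 1)"
  shows "rook_height r < rook_height (swap_at r k)"
  using rook_height_gen_act[of k "swap_at r k"] gen_act_swap_at[OF assms] swap_at_neq[OF assms] assms
  by simp

lemma swap_at_gen_act:
  assumes "0 < k" "k < length s" "gen_act s k \<noteq> s"
  shows "s = swap_at (gen_act s k) k" and "gen_act s k ! k < gen_act s k ! (k - 1)"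
proof -
  have lt: "s ! (k - 1) < s ! k"
    using assms by (auto simp: gen_act_def split: if_splits)
  then show "gen_act s k ! k < gen_act s k ! (k - 1)"
    using assms by (auto simp: gen_act_nth)
  show "s = swap_at (gen_act s k) k"
    by (rule nth_equalityI) (use assms lt in \<open>auto simp: gen_act_nth swap_at_nth\<close>)
qed

lemma swap_at_commute:
  assumes "0 < k" "Suc k < l" "l < length r"
  shows "swap_at (swap_at r k) l = swap_at (swap_at r l) k"
  by (rule nth_equalityI) (use assms in \<open>auto simp: swap_at_nth\<close>)

lemma swap_at_Cons: "Suc 0 < k \<Longrightarrow> swap_at (x # xs) k = x # swap_at xs (k - 1)"
  by (cases k) (auto simp: swap_at_def nth_Cons split: nat.splits)

definition unique_at :: "nat \<Rightarrow> nat list \<Rightarrow> bool" where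
  "unique_at n r \<longleftrightarrow> (\<forall>u\<in>lists {..<n}. \<forall>v\<in>lists {..<n}.
     word_act (id_rook n) u = r \<longrightarrow> word_act (id_rook n) v = r \<longrightarrow> rook_cong n u v)"

lemma unique_atD:
  "unique_at n r \<Longrightarrow> u \<in> lists {..<n} \<Longrightarrow> v \<in> lists {..<n} \<Longrightarrow>
    word_act (id_rook n) u = r \<Longrightarrow> word_act (id_rook n) v = r \<Longrightarrow> rook_cong n u v"
  by (auto simp: unique_at_def)

text \<open>The induction hypothesis for the faithfulness of the action: every proper last step into
  r starts at a higher rook.\<close>

definition unique_above :: "nat \<Rightarrow> nat list \<Rightarrow> bool" where
  "unique_above n r \<longleftrightarrow> (\<forall>s\<in>rooks n. rook_height r < rook_height s \<longrightarrow> unique_at n s)"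

lemma unique_aboveD:
  "unique_above n r \<Longrightarrow> s \<in> rooks n \<Longrightarrow> rook_height r < rook_height s \<Longrightarrow> unique_at n s"
  by (auto simp: unique_above_def)

lemma word_act_snoc: "word_act r (w @ [k]) = gen_act (word_act r w) k"
  by (simp add: word_act_def)

text \<open>A diamond with top q. Uniqueness at its two middle rooks allows u and v to be replaced
  by words through q, after which the given relation closes the diamond.\<close>

lemma rook_cong_join:
  assumes q: "q \<in> rooks n" and w: "w1 \<in> lists {..<n}" "w2 \<in> lists {..<n}"
    and u: "u \<in> lists {..<n}" "word_act (id_rook n) u = word_act q w1"
      "unique_at n (word_act q w1)"
    and v: "v \<in> lists {..<n}" "word_act (id_rook n) v = word_act q w2"
      "unique_at n (word_act q w2)"
    and "rook_cong n (w1 @ [k]) (w2 @ [l])" "k < n" "l < n"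
  shows "rook_cong n (u @ [k]) (v @ [l])"
proof -
  obtain c where c: "c \<in> lists {..<n}" "word_act (id_rook n) c = q"
    using ex_word q by blast
  have "rook_cong n u (c @ w1)"
    using u c w by (intro unique_atD[OF u(3)]) (auto simp: word_act_append)
  then have 1: "rook_cong n (u @ [k]) (c @ w1 @ [k])"
    using rook_cong_snoc[of u "c @ w1" n k] assms by simp
  have "rook_cong n v (c @ w2)"
    using v c w by (intro unique_atD[OF v(3)]) (auto simp: word_act_append)
  then have 2: "rook_cong n (v @ [l]) (c @ w2 @ [l])"
    using rook_cong_snoc[of v "c @ w2" n l] assms by simp
  have "rook_cong n (c @ w1 @ [k]) (c @ w2 @ [l])"
    using assms(10) c(1) by (rule rook_cong_prefix)
  then show ?thesis
    using 1 2 by (meson word_cong.sym word_cong.trans)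
qed

lemma zero_mem_of_missing:
  assumes "distinct_nz ys" "set ys \<subseteq> {0..n}" "A \<subseteq> {1..n}" "A \<inter> set ys = {}" "length ys + card A > n"
  shows "0 \<in> set ys"
proof (rule ccontr)
  assume 0: "0 \<notin> set ys"
  then have "filter (\<lambda>x. x \<noteq> 0) ys = ys" by (auto simp: filter_id_conv intro!: gr0I)
  then have "card (set ys) = length ys"
    using assms(1) by (simp add: distinct_nz_def distinct_card)
  moreover have "card (set ys \<union> A) = card (set ys) + card A"
    using assms(3,4) by (intro card_Un_disjoint) (auto intro: finite_subset)
  moreover have "set ys \<subseteq> {1..n}"
  proof
    fix x assume x: "x \<in> set ys"
    with 0 have "x \<noteq> 0" by metis
    with x assms(2) show "x \<in> {1..n}" by auto
  qed
  then have "card (set ys \<union> A) \<le> card {1..n}"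
    using assms(3) by (intro card_mono) auto
  ultimately show False using assms(5) by simp
qed

text \<open>Here the two predecessors differ in the letter erased. If ys is sorted, the two missing
  letters force a zero into it, hence at its front, and \<open>x # y # zs\<close> lies above both
  with the relation 1010 = 010. Otherwise a descent inside ys is undone by a generator commuting
  with 0, and uniqueness at the higher rook \<open>0 # ys'\<close> applies.\<close>

lemma rook_cong_zero_zero:
  assumes r: "0 # ys \<in> rooks n" and x: "x # ys \<in> rooks n" and y: "y # ys \<in> rooks n" and xy: "0 < x" "x < y"
    and above: "unique_above n (0 # ys)"
    and u: "u \<in> lists {..<n}" "word_act (id_rook n) u = x # ys"
    and v: "v \<in> lists {..<n}" "word_act (id_rook n) v = y # ys"
  shows "rook_cong n (u @ [0]) (v @ [0])"
proof (cases "sorted ys")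
  case True
  have "0 \<in> set ys"
    using x y xy by (intro zero_mem_of_missing[of ys n "{x, y}"]) (auto simp: rooks_iff)
  with True obtain zs where ys: "ys = 0 # zs"
    by (cases ys) auto
  have n: "Suc 0 < n" using r by (auto simp: rooks_iff ys)
  have q: "x # y # zs \<in> rooks n" using x y xy by (auto simp: rooks_iff ys)
  have w1: "word_act (x # y # zs) [Suc 0, 0, Suc 0] = x # ys"
    using xy gen_act_split[of "[]" x y zs] gen_act_split[of "[]" 0 x zs]
    by (simp add: word_act_def gen_act_zero ys)
  have w2: "word_act (x # y # zs) [0, Suc 0] = y # ys"
    using xy gen_act_split[of "[]" 0 y zs] by (simp add: word_act_def gen_act_zero ys)
  show ?thesis
    by (rule rook_cong_join[OF q, of "[Suc 0, 0, Suc 0]" "[0, Suc 0]"])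
      (use n u v w1 w2 x y xy unique_aboveD[OF above] rook_cong_zero(1)[OF n] in \<open>auto simp: rook_height_Cons\<close>)
next
  case False
  then obtain i where i: "Suc i < length ys" "ys ! Suc i < ys ! i"
    by (auto simp: sorted_iff_nth_Suc not_le)
  \<comment> \<open>The front letter shifts the descent of ys by one place, so l is at least 2 and
    commutes with 0.\<close>
  define l where "l = Suc (Suc i)"
  have l: "0 < l" "Suc 0 < l" "l < n" using i r by (auto simp: l_def rooks_iff)
  have d: "(z # ys) ! l < (z # ys) ! (l - 1)" for z using i by (simp add: l_def)
  have len: "length ys = n - 1" using r by (auto simp: rooks_iff)
  define ys' where "ys' = swap_at ys (l - 1)"
  have sw: "swap_at (z # ys) l = z # ys'" for z
    using l by (simp add: swap_at_Cons ys'_def)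
  have ga: "gen_act (z # ys') l = z # ys" for z
    using gen_act_swap_at[OF l(1) _ d, of z] l len unfolding sw by simp
  have rk: "0 # ys' \<in> rooks n" "x # ys' \<in> rooks n" "y # ys' \<in> rooks n"
    using swap_at_rooks[OF _ l(1,3)] r x y unfolding sw[symmetric] by auto
  have ht: "rook_height (0 # ys) < rook_height (0 # ys')"
    using rook_height_swap_at[OF l(1) _ d, of 0] l len unfolding sw by simp
  obtain c where c: "c \<in> lists {..<n}" "word_act (id_rook n) c = x # ys'"
    using ex_word rk by blast
  obtain e where e: "e \<in> lists {..<n}" "word_act (id_rook n) e = y # ys'"
    using ex_word rk by blast
  have 1: "rook_cong n u (c @ [l])"
    using u c ga l x xy by (intro unique_atD[OF unique_aboveD[OF above, of "x # ys"]]) (auto simp: word_act_snoc rook_height_Cons)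
  have 2: "rook_cong n v (e @ [l])"
    using v e ga l y xy by (intro unique_atD[OF unique_aboveD[OF above, of "y # ys"]]) (auto simp: word_act_snoc rook_height_Cons)
  have 3: "rook_cong n (c @ [0]) (e @ [0])"
    using c e l by (intro unique_atD[OF unique_aboveD[OF above rk(1) ht]]) (auto simp: word_act_snoc gen_act_zero)
  have cm: "rook_cong n [l, 0] [0, l]"
    using l by (intro rook_cong_commute) auto
  have "rook_cong n (u @ [0]) (c @ [l, 0])"
    using rook_cong_snoc[OF 1, of 0] l by simp
  also have "rook_cong n (c @ [l, 0]) (c @ [0, l])"
    using cm c(1) by (rule rook_cong_prefix)
  also (word_cong.trans) have "rook_cong n (c @ [0, l]) (e @ [0, l])"
    using rook_cong_snoc[OF 3, of l] l by simp
  also (word_cong.trans) have "rook_cong n (e @ [0, l]) (e @ [l, 0])"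
    using word_cong.sym[OF cm] e(1) by (rule rook_cong_prefix)
  also (word_cong.trans) have "rook_cong n (e @ [l, 0]) (v @ [0])"
    using word_cong.sym[OF rook_cong_snoc[OF 2, of 0]] l by simp
  finally (word_cong.trans) show ?thesis .
qed

text \<open>Undoing both steps leads to a common rook above, except for k = l = 0, where
  \<open>rook_cong_zero_zero\<close> takes over if the erased letters differ.\<close>

lemma rook_cong_proper_steps:
  assumes r: "r \<in> rooks n"
    and above: "unique_above n r"
    and u: "u \<in> lists {..<n}" "k < n" "word_act (id_rook n) u \<noteq> r" "word_act (id_rook n) (u @ [k]) = r"
    and v: "v \<in> lists {..<n}" "l < n" "word_act (id_rook n) v \<noteq> r" "word_act (id_rook n) (v @ [l]) = r"
  shows "rook_cong n (u @ [k]) (v @ [l])"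
  using u v
proof (induction k l arbitrary: u v rule: linorder_wlog)
  case (sym k l)
  then show ?case using word_cong.sym by blast
next
  case (le k l)
  define s where "s = word_act (id_rook n) u"
  define t where "t = word_act (id_rook n) v"
  have s: "s \<in> rooks n" "gen_act s k = r" "s \<noteq> r" "length s = n"
    using le.prems word_act_rooks[OF id_rook_rooks, of u n] by (auto simp: s_def word_act_snoc)
  have t: "t \<in> rooks n" "gen_act t l = r" "t \<noteq> r" "length t = n"
    using le.prems word_act_rooks[OF id_rook_rooks, of v n] by (auto simp: t_def word_act_snoc)
  have us: "unique_at n s"
    using unique_aboveD[OF above s(1)] rook_height_gen_act[of k s] s le.prems by auto
  have ut: "unique_at n t"
    using unique_aboveD[OF above t(1)] rook_height_gen_act[of l t] t le.prems by auto
  have lr: "length r = n" using r by (simp add: rooks_iff)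
  have join: "rook_cong n (u @ [k]) (v @ [l])"
    if "q \<in> rooks n" "w1 \<in> lists {..<n}" "w2 \<in> lists {..<n}" "word_act q w1 = s" "word_act q w2 = t"
      "rook_cong n (w1 @ [k]) (w2 @ [l])" for q w1 w2
    using rook_cong_join[OF that(1-3), of u v k l] that(4-6) le.prems us ut by (auto simp: s_def t_def)
  have Sk: "s = swap_at r k" "r ! k < r ! (k - 1)" if "0 < k"
    using swap_at_gen_act[OF that, of s] s le.prems by auto
  have Tl: "t = swap_at r l" "r ! l < r ! (l - 1)" if "0 < l"
    using swap_at_gen_act[OF that, of t] t le.prems by auto
  consider "k = l" "0 < k" | "k = 0" "l = 0" | "k = 0" "l = Suc 0" | "l = Suc k" "0 < k" | "k = 0" "Suc k < l"
    | "Suc k < l" "0 < k"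
    using le.hyps by linarith
  then show ?case
  proof cases
    case 1
    then show ?thesis using join[of s "[]" "[]"] s Sk Tl le.prems
        word_cong.refl[of "[l]" "{..<n}" "rook_rels n"]
      by (auto simp: word_act_def)
  next
    case 2
    obtain x ys where x: "s = x # ys" using s le.prems by (cases s) auto
    obtain y zs where y: "t = y # zs" using t le.prems by (cases t) auto
    have r0: "r = 0 # ys" "zs = ys" using x y s t 2 by (auto simp: gen_act_zero)
    have xy0: "x \<noteq> 0" "y \<noteq> 0" using x y r0 s t by auto
    consider "x = y" | "x < y" | "y < x" by linarith
    then show ?thesis
    proof cases
      case 1
      then show ?thesis using join[of s "[]" "[]"] s x y r0 2 le.prems
          word_cong.refl[of "[0]" "{..<n}" "rook_rels n"]
        by (auto simp: word_act_def)
    next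
      case c: 2
      show ?thesis using rook_cong_zero_zero[of ys n x y u v] r s t x y r0 xy0 c above le.prems 2
        by (auto simp: s_def t_def)
    next
      case c: 3
      show ?thesis using word_cong.sym[OF rook_cong_zero_zero[of ys n y x v u]] r s t x y r0 xy0 c above le.prems 2
        by (auto simp: s_def t_def)
    qed
  next
    \<comment> \<open>Cannot occur: the move 0 leaves 0 in front, but a proper move 1 leaves a
      descent there.\<close>
    case 3
    obtain x ys where x: "s = x # ys" using s le.prems by (cases s) auto
    then have "r ! 0 = 0" using s 3 by (auto simp: gen_act_zero)
    then show ?thesis using Tl 3 by simp
  next
    case 4
    obtain xs c d ys' where r': "r = xs @ c # d # ys'" and k: "k = Suc (length xs)"
      using gen_cases[of k r] 4 le.prems lr by (metis less_numeral_extra(3))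
    with 4 le.prems lr obtain b a ys where rr: "r = xs @ c # b # a # ys"
      by (cases ys') auto
    have cb: "b < c" using Sk 4 by (simp add: rr k nth_append)
    have ba: "a < b" using Tl 4 by (simp add: rr k nth_append)
    have "swap_at r k = xs @ b # c # a # ys"
      by (simp add: swap_at_split rr k)
    then have s': "s = xs @ b # c # a # ys" using Sk 4 by simp
    have "swap_at r l = xs @ c # a # b # ys"
      using 4 swap_at_split[of "xs @ [c]" b a ys] by (simp add: rr k)
    then have t': "t = xs @ c # a # b # ys" using Tl 4 by simp
    \<comment> \<open>The common rook has the three letters in increasing order; the two halves of
      the braid lead from it to s and t.\<close>
    have q: "xs @ a # b # c # ys \<in> rooks n"
      using r cb ba by (auto simp: rr rooks_iff)
    have w1: "word_act (xs @ a # b # c # ys) [k, Suc k] = s"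
      using gen_act_split[of xs a b "c # ys"] gen_act_split[of "xs @ [b]" a c ys] cb ba
      by (simp add: word_act_def k s')
    have w2: "word_act (xs @ a # b # c # ys) [Suc k, k] = t"
      using gen_act_split[of "xs @ [a]" b c ys] gen_act_split[of xs a c "b # ys"] cb ba
      by (simp add: word_act_def k t')
    show ?thesis
      using join[OF q _ _ w1 w2] rook_cong_braid[of k n] 4 le.prems by auto
  next
    case 5
    obtain x ys where x: "s = x # ys" using s le.prems by (cases s) auto
    have r0: "r = 0 # ys" using x s 5 by (auto simp: gen_act_zero)
    define q where "q = swap_at s l"
    have "q \<in> rooks n" using swap_at_rooks[of s n l] s le.prems 5 by (simp add: q_def)
    moreover have "gen_act q l = s"
      unfolding q_def using Tl 5 s le.prems by (intro gen_act_swap_at) (auto simp: x r0 nth_Cons split: nat.splits)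
    moreover have "gen_act q 0 = t"
      using Tl 5 by (simp add: q_def x r0 swap_at_Cons gen_act_zero)
    ultimately show ?thesis
      using join[of q "[l]" "[k]"] 5 le.prems rook_cong_commute[of l n k] by (auto simp: word_act_def)
  next
    case 6
    define q where "q = swap_at s l"
    have "q \<in> rooks n" using swap_at_rooks[of s n l] s le.prems 6 by (simp add: q_def)
    moreover have "gen_act q l = s"
      unfolding q_def using Tl Sk 6 s le.prems lr by (intro gen_act_swap_at) (auto simp: swap_at_nth)
    moreover have "q = swap_at t k"
      using swap_at_commute[of k l r] Sk Tl 6 le.prems lr by (simp add: q_def)
    then have "gen_act q k = t"
      using Tl Sk 6 t le.prems lr by (auto intro!: gen_act_swap_at simp: swap_at_nth)
    ultimately show ?thesis
      using join[of q "[l]" "[k]"] 6 le.prems rook_cong_commute[of l n k] by (auto simp: word_act_def)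
  qed
qed

section \<open>Absorbing letters that fix the rook\<close>

lemma ex_missing:
  assumes "r \<in> rooks n" "count_list r 0 > card A" "finite A"
  obtains x where "0 < x" "x \<le> n" "x \<notin> set r" "x \<notin> A"
proof -
  have "card ((set r - {0}) \<union> A) \<le> card (set r - {0}) + card A"
    by (rule card_Un_le)
  also have "\<dots> < card {1..n}"
    using length_eq_count_list_zero[of r] assms by (simp add: rooks_iff)
  finally have "\<not> {1..n} \<subseteq> (set r - {0}) \<union> A"
    using card_mono[of "(set r - {0}) \<union> A" "{1..n}"] assms(3) by auto
  then show ?thesis using that by (auto simp: subset_iff Suc_le_eq)
qed

lemma gen_act_eq_iff:
  assumes "0 < k" "k < length r"
  shows "gen_act r k = r \<longleftrightarrow> r ! k \<le> r ! (k - 1)"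
proof
  assume "gen_act r k = r"
  moreover have "gen_act r k ! k = min (r ! (k - 1)) (r ! k)"
    using assms by (auto simp: gen_act_nth)
  ultimately show "r ! k \<le> r ! (k - 1)" by (metis min.cobounded1)
qed (use assms in \<open>simp add: gen_act_def\<close>)

lemma rook_nth_eq:
  assumes "r \<in> rooks n" "i < j" "j < n" "r ! i = r ! j"
  shows "r ! j = 0"
proof -
  have "r = take j r @ r ! j # drop (Suc j) r"
    using assms by (simp add: id_take_nth_drop[symmetric] rooks_iff)
  then have "distinct_nz (take j r @ r ! j # drop (Suc j) r)"
    using assms(1) by (simp add: rooks_iff)
  moreover have "r ! i \<in> set (take j r)"
    using assms by (auto simp: in_set_conv_nth rooks_iff intro!: exI[of _ i])
  ultimately show ?thesis using assms(4) by auto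
qed

text \<open>It is enough to absorb k behind one well chosen proper word, since
  \<open>rook_cong_proper_steps\<close> identifies all proper words into r. A front zero or a
  descent allows k itself as last step, and idempotence absorbs the repetition. The remaining case
  is a pair of zeros, as only zeros can be repeated.\<close>

lemma ex_proper_absorb:
  assumes r: "r \<in> rooks n"
    and above: "unique_above n r"
    and k: "k < n" "gen_act r k = r"
  obtains w m where "w \<in> lists {..<n}" "m < n" "word_act (id_rook n) w \<noteq> r"
    "word_act (id_rook n) (w @ [m]) = r" "rook_cong n (w @ [m, k]) (w @ [m])"
proof -
  note intro_result = that
  have lr: "length r = n" using r by (simp add: rooks_iff)
  have via: thesis
    if q: "q \<in> rooks n" and p: "p \<in> lists {..<n}" and m: "m < n"
      and "word_act q p \<noteq> r" "word_act q (p @ [m]) = r"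
      and c: "\<And>c. c \<in> lists {..<n} \<Longrightarrow> word_act (id_rook n) c = q \<Longrightarrow>
        rook_cong n (c @ p @ [m, k]) (c @ p @ [m])" for q p m
  proof -
    obtain c where "c \<in> lists {..<n}" "word_act (id_rook n) c = q"
      using ex_word q by blast
    then show thesis
      using that(2-5) c[of c] by (intro intro_result[of "c @ p" m]) (auto simp: word_act_append)
  qed
  \<comment> \<open>At a rook above r uniqueness is available and absorbs such letters at
    once.\<close>
  have fixes_above: "rook_cong n (c @ [l]) c"
    if "s \<in> rooks n" "rook_height r < rook_height s" "gen_act s l = s" "l < n"
      "c \<in> lists {..<n}" "word_act (id_rook n) c = s" for c s l
    using that by (intro unique_atD[OF unique_aboveD[OF above that(1,2)]]) (auto simp: word_act_snoc)
  have commuting: "rook_cong n (c @ [m, k]) (c @ [m])"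
    if s: "s \<in> rooks n" "rook_height r < rook_height s" "gen_act s k = s"
      and c: "c \<in> lists {..<n}" "word_act (id_rook n) c = s" and m: "Suc m < k" for c s m
  proof -
    have "rook_cong n (c @ [m, k]) (c @ [k, m])"
      using m k c by (intro rook_cong_prefix rook_cong_commute) auto
    also have "rook_cong n (c @ [k, m]) (c @ [m])"
      using rook_cong_snoc[OF fixes_above[OF s k(1) c], of m] m k by simp
    finally (word_cong.trans) show ?thesis .
  qed
  have idem: "rook_cong n (c @ [k, k]) (c @ [k])" if "c \<in> lists {..<n}" for c
    using that k by (intro rook_cong_prefix rook_cong_idem) auto
  consider "k = 0" | "0 < k" "r ! k < r ! (k - 1)" | "0 < k" "r ! k = r ! (k - 1)"
    using gen_act_eq_iff[of k r] k lr by force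
  then show thesis
  proof cases
    case 1
    then obtain ys where r0: "r = 0 # ys" using k lr by (cases r) (auto simp: gen_act_zero)
    obtain x where x: "0 < x" "x \<le> n" "x \<notin> set r"
      using ex_missing[of r n "{}"] r r0 by auto
    show thesis
      by (rule via[of "x # ys" "[]" 0])
        (use r r0 x k 1 idem in \<open>auto simp: rooks_iff word_act_def gen_act_zero\<close>)
  next
    case 2
    show thesis
      by (rule via[of "swap_at r k" "[]" k])
        (use r k 2 idem lr swap_at_rooks gen_act_swap_at swap_at_neq in \<open>auto simp: word_act_def\<close>)
  next
    case 3
    then have z: "r ! k = 0" "r ! (k - 1) = 0"
      using rook_nth_eq[OF r, of "k - 1" k] k by auto
    show thesis
    proof (cases "r ! 0 = 0")
      case True
      then obtain ys where r0: "r = 0 # ys" using k lr by (cases r) auto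
      show thesis
      proof (cases "k = 1")
        case True
        with r0 z k lr obtain zs where zs: "ys = 0 # zs" by (cases ys) auto
        obtain x where x: "0 < x" "x \<le> n" "x \<notin> set r"
          using ex_missing[of r n "{}"] r r0 by auto
        obtain y where y: "0 < y" "y \<le> n" "y \<notin> set r" "y \<noteq> x"
          using ex_missing[of r n "{x}"] r r0 zs by auto
        have gs: "gen_act (0 # b # zs) (Suc 0) = b # 0 # zs" if "0 < b" for b
          using gen_act_split[of "[]" 0 b zs] that by simp
        \<comment> \<open>Two zeros in front: both come from erasing x and y by 0, 1, 0, and the
          relation 0101 = 010 absorbs the letter 1.\<close>
        show thesis
        proof (rule via[of "x # y # zs" "[0, 1]" 0])
          fix c assume c: "c \<in> lists {..<n}" "word_act (id_rook n) c = x # y # zs"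
          show "rook_cong n (c @ [0, 1] @ [0, k]) (c @ [0, 1] @ [0])"
            using rook_cong_prefix[OF rook_cong_zero(2)[of n] c(1)] True k by simp
        qed (use r r0 zs x y k True gs in \<open>auto simp: rooks_iff word_act_def gen_act_zero\<close>)
      next
        case False
        obtain x where x: "0 < x" "x \<le> n" "x \<notin> set r"
          using ex_missing[of r n "{}"] r r0 by auto
        have s: "x # ys \<in> rooks n" "rook_height r < rook_height (x # ys)"
          using r r0 x by (auto simp: rooks_iff rook_height_Cons)
        moreover have "gen_act (x # ys) k = x # ys"
          using False 3 z k lr r0 by (subst gen_act_eq_iff) (auto simp: nth_Cons split: nat.splits)
        ultimately show thesis
          using False 3 r0 x k commuting by (intro via[of "x # ys" "[]" 0]) (auto simp: word_act_def gen_act_zero)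
      qed
    next
      case False
      \<comment> \<open>The index of the first zero. As r does not start with 0, there is a descent
        into it, so l can be the last step.\<close>
      define l where "l = (LEAST j. r ! j = 0)"
      have l0: "r ! l = 0" unfolding l_def using z(1) by (rule LeastI)
      have lk: "l \<le> k - 1" unfolding l_def using z(2) by (rule Least_le)
      have "0 < l" using l0 False by (cases l) auto
      have "r ! (l - 1) \<noteq> 0"
        using not_less_Least[of "l - 1" "\<lambda>j. r ! j = 0"] \<open>0 < l\<close> by (simp add: l_def)
      then have desc: "r ! l < r ! (l - 1)" using l0 by simp
      have ln: "l < n" using lk k by simp
      have s: "swap_at r l \<in> rooks n" "rook_height r < rook_height (swap_at r l)"
        "gen_act (swap_at r l) l = r" "swap_at r l \<noteq> r"
        using swap_at_rooks[OF r] rook_height_swap_at gen_act_swap_at swap_at_neq \<open>0 < l\<close> ln desc lr by auto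
      show thesis
      proof (cases "Suc l < k")
        case True
        have "gen_act (swap_at r l) k = swap_at r l"
          using True 3 z k lr \<open>0 < l\<close> by (subst gen_act_eq_iff) (auto simp: swap_at_nth)
        then have "rook_cong n (c @ [l, k]) (c @ [l])"
          if "c \<in> lists {..<n}" "word_act (id_rook n) c = swap_at r l" for c
          using commuting[OF s(1,2)] that True by blast
        then show thesis
          by (intro via[OF s(1) _ ln, of "[]"]) (simp_all add: word_act_def s)
      next
        case False
        then have kl: "k = Suc l" using lk 3 by simp
        \<comment> \<open>Where r has b 0 0, the rook q has 0 0 b, so l fixes q. Then klk = lkl by
          the braid relation, and its leading l is absorbed at q, leaving kl.\<close>
        define q where "q = swap_at (swap_at r l) k"
        have d: "swap_at r l ! k < swap_at r l ! (k - 1)"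
          using kl desc k lr z \<open>0 < l\<close> by (cases l) (simp_all add: swap_at_nth)
        have q: "q \<in> rooks n" "rook_height (swap_at r l) < rook_height q" "gen_act q k = swap_at r l"
          using swap_at_rooks[OF s(1)] rook_height_swap_at[OF _ _ d] gen_act_swap_at[OF _ _ d] k kl lr
          by (auto simp: q_def)
        obtain l' where "l = Suc l'" using \<open>0 < l\<close> by (cases l) auto
        then have "q ! l = 0"
          using kl k lr z l0 by (simp add: q_def swap_at_nth)
        then have ql: "gen_act q l = q"
          using gen_act_eq_iff[of l q] \<open>0 < l\<close> ln lr by (simp add: q_def)
        show thesis
        proof (rule via[of q "[k]" l])
          fix c assume c: "c \<in> lists {..<n}" "word_act (id_rook n) c = q"
          have br: "rook_cong n (c @ [l, k, l]) (c @ [k, l, k])"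
            using rook_cong_prefix[OF rook_cong_braid[of l n] c(1)] \<open>0 < l\<close> kl k by simp
          have cl: "rook_cong n (c @ [l]) c"
            using fixes_above[OF q(1) _ ql ln c] q(2) s(2) by simp
          have "rook_cong n (c @ [l] @ [k, l]) (c @ [k, l])"
            using rook_cong_context[OF cl, of "[]" "[k, l]"] k ln by simp
          then have "rook_cong n (c @ [l, k, l]) (c @ [k, l])" by simp
          with word_cong.sym[OF br] have "rook_cong n (c @ [k, l, k]) (c @ [k, l])"
            by (rule word_cong.trans)
          then show "rook_cong n (c @ [k] @ [l, k]) (c @ [k] @ [l])" by simp
        qed (simp_all add: word_act_def q s ln k)
      qed
    qed
  qed
qed

text \<open>Letters are removed from the right: if the last one fixes r, the shorter word is first
  brought into the form behind which \<open>ex_proper_absorb\<close> removes that letter.\<close>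

lemma ex_proper_last:
  assumes r: "r \<in> rooks n"
    and above: "unique_above n r"
    and "r \<noteq> id_rook n" "u \<in> lists {..<n}" "word_act (id_rook n) u = r"
  shows "\<exists>w m. w \<in> lists {..<n} \<and> m < n \<and> word_act (id_rook n) w \<noteq> r
    \<and> word_act (id_rook n) (w @ [m]) = r \<and> rook_cong n u (w @ [m])"
  using assms(4,5)
proof (induction u rule: rev_induct)
  case Nil
  then show ?case using assms(3) by (simp add: word_act_def)
next
  case (snoc k u)
  have k: "k < n" "u \<in> lists {..<n}" using snoc.prems by auto
  show ?case
  proof (cases "word_act (id_rook n) u = r")
    case False
    show ?thesis
      using k False snoc.prems(2) word_cong.refl[OF snoc.prems(1)]
      by (intro exI[of _ u] exI[of _ k] conjI)
  next
    case True
    then have "gen_act r k = r" using snoc.prems by (simp add: word_act_snoc)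
    then obtain w m where w: "w \<in> lists {..<n}" "m < n" "word_act (id_rook n) w \<noteq> r"
      "word_act (id_rook n) (w @ [m]) = r" "rook_cong n (w @ [m, k]) (w @ [m])"
      by (rule ex_proper_absorb[OF r above k(1)])
    obtain w' m' where w': "w' \<in> lists {..<n}" "m' < n" "word_act (id_rook n) w' \<noteq> r"
      "word_act (id_rook n) (w' @ [m']) = r" "rook_cong n u (w' @ [m'])"
      using snoc.IH[OF k(2) True] by (elim exE conjE)
    have "rook_cong n (w' @ [m']) (w @ [m])"
      by (rule rook_cong_proper_steps[OF r above w'(1-4) w(1-4)])
    with w'(5) have "rook_cong n u (w @ [m])" by (rule word_cong.trans)
    then have "rook_cong n (u @ [k]) (w @ [m, k])"
      using rook_cong_snoc[of u "w @ [m]" n k] k by simp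
    then have "rook_cong n (u @ [k]) (w @ [m])" using w(5) by (rule word_cong.trans)
    with w(1-4) show ?thesis by (intro exI[of _ w] exI[of _ m] conjI)
  qed
qed

lemma gen_act_id_rook: "k < n \<Longrightarrow> gen_act (id_rook n) k \<noteq> id_rook n"
proof (cases "k = 0")
  case True
  assume "k < n"
  then have "id_rook n = 1 # [2..<Suc n]"
    by (simp add: id_rook_def upt_conv_Cons numeral_2_eq_2 del: upt_Suc)
  with True show ?thesis by (simp add: gen_act_zero)
next
  case False
  assume "k < n"
  with False show ?thesis
    by (subst gen_act_eq_iff) (auto simp: id_rook_def simp del: upt_Suc)
qed

lemma word_act_id_rook_eq:
  assumes "w \<in> lists {..<n}" "word_act (id_rook n) w = id_rook n"
  shows "w = []"
proof (cases w)
  case (Cons k u)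
  then have k: "k < n" and u: "u \<in> lists {..<n}" using assms by auto
  have "reach (gen_act (id_rook n) k) (id_rook n)"
    unfolding reach_def using u assms(2) Cons by (auto simp: word_act_def)
  then have "gen_act (id_rook n) k = id_rook n"
    using k by (intro reach_antisym reach_gen_act) auto
  then show ?thesis using gen_act_id_rook k by blast
qed

lemma unique_at_rook: "r \<in> rooks n \<Longrightarrow> unique_at n r"
proof (induction "rook_height (id_rook n) - rook_height r" arbitrary: r rule: less_induct)
  case less
  have above: "unique_above n r"
    unfolding unique_above_def
  proof (intro ballI impI)
    fix s assume "s \<in> rooks n" "rook_height r < rook_height s"
    then show "unique_at n s"
      using less.hyps[of s] rook_height_le_id_rook[of s n] by simp
  qed
  show ?case
    unfolding unique_at_def
  proof (intro ballI impI)
    fix u v assume u: "u \<in> lists {..<n}" "word_act (id_rook n) u = r"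
      and v: "v \<in> lists {..<n}" "word_act (id_rook n) v = r"
    show "rook_cong n u v"
    proof (cases "r = id_rook n")
      case True
      then have "u = []" "v = []" using u v word_act_id_rook_eq by auto
      then show ?thesis by (simp add: word_cong.refl)
    next
      case False
      obtain u' k where u': "u' \<in> lists {..<n}" "k < n" "word_act (id_rook n) u' \<noteq> r"
        "word_act (id_rook n) (u' @ [k]) = r" "rook_cong n u (u' @ [k])"
        using ex_proper_last[OF less.prems above False u] by (elim exE conjE)
      obtain v' l where v': "v' \<in> lists {..<n}" "l < n" "word_act (id_rook n) v' \<noteq> r"
        "word_act (id_rook n) (v' @ [l]) = r" "rook_cong n v (v' @ [l])"
        using ex_proper_last[OF less.prems above False v] by (elim exE conjE)
      have "rook_cong n (u' @ [k]) (v' @ [l])"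
        by (rule rook_cong_proper_steps[OF less.prems above u'(1-4) v'(1-4)])
      with u'(5) have "rook_cong n u (v' @ [l])" by (rule word_cong.trans)
      then show ?thesis using word_cong.sym[OF v'(5)] by (rule word_cong.trans)
    qed
  qed
qed

lemma rook_cong_iff:
  assumes "u \<in> lists {..<n}" "v \<in> lists {..<n}"
  shows "rook_cong n u v \<longleftrightarrow> word_act (id_rook n) u = word_act (id_rook n) v"
proof
  assume "rook_cong n u v"
  then show "word_act (id_rook n) u = word_act (id_rook n) v"
    by (rule word_act_cong) simp
next
  assume "word_act (id_rook n) u = word_act (id_rook n) v"
  then show "rook_cong n u v"
    using unique_atD[OF unique_at_rook[OF word_act_rooks[OF id_rook_rooks assms(1)]]] assms by metis
qed

section \<open>Transposition\<close>

text \<open>With positions counted from 1, \<open>dom_count r i j\<close> is the number of positions beyond \<open>i\<close>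
  carrying a letter beyond \<open>j\<close>, a corner sum of the rook matrix. Transposing the matrix
  exchanges \<open>i\<close> and \<open>j\<close>.\<close>

definition dom_count :: "nat list \<Rightarrow> nat \<Rightarrow> nat \<Rightarrow> nat" where
  "dom_count r i j = length (filter (\<lambda>x. j < x) (drop i r))"

text \<open>The effect of generator k on corner sums. Let c be the entry in row k + 1. Row k - 1 has
  c + 2, c + 1 or c there, according to how many of the two exchanged letters exceed j; the new
  entry in row k has to be c + 1 in the first case and c otherwise. The maximum with truncated
  decrement gives this without comparing letters.\<close>

definition row_op :: "nat \<Rightarrow> (nat \<Rightarrow> nat \<Rightarrow> nat) \<Rightarrow> nat \<Rightarrow> nat \<Rightarrow> nat" where
  "row_op k f i j =
    (if i \<noteq> k then f i j
     else if k = 0 then f (Suc 0) j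
     else max (f (k - 1) j - 1) (f (Suc k) j))"

definition transpose_fun :: "(nat \<Rightarrow> nat \<Rightarrow> nat) \<Rightarrow> nat \<Rightarrow> nat \<Rightarrow> nat" where
  "transpose_fun f i j = f j i"

definition col_op :: "nat \<Rightarrow> (nat \<Rightarrow> nat \<Rightarrow> nat) \<Rightarrow> nat \<Rightarrow> nat \<Rightarrow> nat" where
  "col_op k f = transpose_fun (row_op k (transpose_fun f))"

lemma transpose_fun_transpose_fun [simp]: "transpose_fun (transpose_fun f) = f"
  by (simp add: transpose_fun_def fun_eq_iff)

text \<open>Truncated decrement distributes over maximum, and the two operations shift different
  indices.\<close>

lemma row_op_col_op_commute: "row_op k (col_op l f) = col_op l (row_op k f)"
proof -
  have "max a b - Suc 0 = max (a - Suc 0) (b - Suc 0)" for a b by (simp add: max_def)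
  then show ?thesis
    by (intro ext) (simp add: row_op_def col_op_def transpose_fun_def max.assoc max.left_commute max.commute)
qed

lemma dom_count_gen_act:
  assumes "k < length r"
  shows "dom_count (gen_act r k) = row_op k (dom_count r)"
  using assms
proof (cases rule: gen_cases)
  case (zero x xs)
  have "dom_count (0 # xs) i j = row_op 0 (dom_count (x # xs)) i j" for i j
    by (cases i) (simp_all add: dom_count_def row_op_def)
  then show ?thesis unfolding zero gen_act_zero by (intro ext)
next
  case (swap xs a b ys)
  have "dom_count (gen_act r k) i j = row_op k (dom_count r) i j" for i j
  proof -
    define c where "c = length (filter (\<lambda>x. j < x) ys)"
    consider "i \<le> length xs" | "i = Suc (length xs)" | "Suc (length xs) < i"
      using linorder_less_linear[of i "Suc (length xs)"] less_Suc_eq_le by blast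
    then show ?thesis
    proof cases
      case 1
      have "length (filter (\<lambda>x. j < x) (drop i (xs @ a # b # ys))) =
          length (filter (\<lambda>x. j < x) (drop i (xs @ b # a # ys)))"
        using 1 by simp
      then show ?thesis
        using 1 by (simp add: swap gen_act_split dom_count_def row_op_def)
    next
      case 2
      have "dom_count r (k - 1) j = of_bool (j < a) + of_bool (j < b) + c"
        "dom_count r (Suc k) j = c"
        by (simp_all add: swap dom_count_def c_def)
      moreover have "dom_count (gen_act r k) i j = of_bool (j < a \<and> j < b) + c"
        using 2 by (auto simp: swap gen_act_split dom_count_def c_def)
      ultimately show ?thesis
        using 2 swap(1) by (simp add: row_op_def)
    next
      case 3
      define d where "d = i - Suc (Suc (length xs))"
      have i: "i = Suc (Suc (length xs + d))" using 3 by (simp add: d_def)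
      show ?thesis
        by (simp add: i swap gen_act_split dom_count_def row_op_def)
    qed
  qed
  then show ?thesis by (intro ext)
qed

lemma dom_count_inj: "length r = length s \<Longrightarrow> dom_count r = dom_count s \<Longrightarrow> r = s"
proof (induction r s rule: list_induct2)
  case (Cons x xs y ys)
  have *: "dom_count (x # xs) i j = dom_count (y # ys) i j" for i j
    using Cons.prems by simp
  have "dom_count xs i j = dom_count ys i j" for i j
    using *[of "Suc i" j] by (simp add: dom_count_def)
  then have eq: "xs = ys" by (intro Cons.IH) (simp add: fun_eq_iff)
  have "j < x \<longleftrightarrow> j < y" for j
    using *[of 0 j] unfolding eq by (auto simp: dom_count_def split: if_splits)
  then have "x = y" by (metis less_irrefl nat_neq_iff)
  with eq show ?case by simp
qed simp

lemma dom_count_id_rook: "dom_count (id_rook n) i j = n - max i j"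
proof -
  have "length (filter (\<lambda>x. j < x) [Suc i..<Suc n]) = n - max i j" for n
    by (induction n) (auto simp: max_def Suc_diff_le)
  then show ?thesis by (simp add: dom_count_def id_rook_def del: upt_Suc)
qed

lemma transpose_dom_count_id_rook: "transpose_fun (dom_count (id_rook n)) = dom_count (id_rook n)"
  by (simp add: fun_eq_iff transpose_fun_def dom_count_id_rook max.commute)

text \<open>In the corner sums n - max i j both operations change only the diagonal entry (k, k),
  lowering it by one.\<close>

lemma row_op_id_rook:
  "k < n \<Longrightarrow> row_op k (dom_count (id_rook n)) = col_op k (dom_count (id_rook n))"
  by (auto simp: fun_eq_iff row_op_def col_op_def transpose_fun_def dom_count_id_rook max_def)

lemma dom_count_word_act:
  "w \<in> lists {..<length r} \<Longrightarrow>
    dom_count (word_act r w) = foldl (\<lambda>f k. row_op k f) (dom_count r) w"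
proof (induction w rule: rev_induct)
  case Nil
  then show ?case by (simp add: word_act_def)
next
  case (snoc k w)
  then show ?case by (simp add: word_act_snoc dom_count_gen_act)
qed

lemma foldl_col_op: "foldl (\<lambda>f k. col_op k f) f w = transpose_fun (foldl (\<lambda>f k. row_op k f) (transpose_fun f) w)"
  by (induction w rule: rev_induct) (simp_all add: col_op_def)

lemma row_op_foldl_col_op:
  "row_op k (foldl (\<lambda>f k. col_op k f) f w) = foldl (\<lambda>f k. col_op k f) (row_op k f) w"
  by (induction w rule: rev_induct) (simp_all add: row_op_col_op_commute)

text \<open>A word acts on the columns of the symmetric identity matrix as its reversal acts on the
  rows, because row and column operations commute.\<close>

lemma dom_count_rev:
  assumes "w \<in> lists {..<n}"
  shows "dom_count (word_act (id_rook n) (rev w)) = transpose_fun (dom_count (word_act (id_rook n) w))"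
proof -
  let ?I = "dom_count (id_rook n)"
  have rows: "foldl (\<lambda>f k. row_op k f) ?I w = foldl (\<lambda>f k. col_op k f) ?I (rev w)"
    using assms
  proof (induction w rule: rev_induct)
    case (snoc k w)
    then have "k < n" by simp
    with snoc show ?case by (simp add: row_op_foldl_col_op row_op_id_rook)
  qed simp
  have "dom_count (word_act (id_rook n) w) = transpose_fun (foldl (\<lambda>f k. row_op k f) ?I (rev w))"
    using assms rows by (simp add: dom_count_word_act foldl_col_op transpose_dom_count_id_rook)
  moreover have "dom_count (word_act (id_rook n) (rev w)) = foldl (\<lambda>f k. row_op k f) ?I (rev w)"
    using assms by (intro dom_count_word_act) auto
  ultimately show ?thesis by simp
qed

text \<open>Transposing corner sums is injective, so reversal of words respects the congruence and
  induces an anti-automorphism of the monoid.\<close>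

lemma word_act_rev_eq_iff:
  assumes "u \<in> lists {..<n}" "v \<in> lists {..<n}"
  shows "word_act (id_rook n) (rev u) = word_act (id_rook n) (rev v) \<longleftrightarrow>
    word_act (id_rook n) u = word_act (id_rook n) v"
proof -
  have "dom_count (word_act (id_rook n) (rev u)) = dom_count (word_act (id_rook n) (rev v)) \<longleftrightarrow>
    dom_count (word_act (id_rook n) u) = dom_count (word_act (id_rook n) v)"
    unfolding dom_count_rev[OF assms(1)] dom_count_rev[OF assms(2)] by (metis transpose_fun_transpose_fun)
  then show ?thesis by (metis dom_count_inj length_word_act)
qed

section \<open>The stellar map and the action\<close>

definition cut_below :: "nat \<Rightarrow> nat list \<Rightarrow> nat list" where
  "cut_below m r = map (\<lambda>x. if x < m then 0 else x) r"

text \<open>The inserted 0 makes the case without missing letters a cut below 0, which changes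
  nothing.\<close>

definition max_missing :: "nat \<Rightarrow> nat list \<Rightarrow> nat" where
  "max_missing n r = Max (insert 0 (missing n r))"

lemma finite_missing [simp]: "finite (missing n r)"
  by (simp add: missing_def)

lemma stell_map_eq: "stell_map n r = cut_below (max_missing n r) r"
proof (cases "missing n r = {}")
  case False
  then have "max_missing n r = Max (missing n r)" by (simp add: max_missing_def)
  with False show ?thesis by (simp add: stell_map_def cut_below_def)
qed (simp add: stell_map_def cut_below_def max_missing_def)

lemma missing_cut_below: "missing n (cut_below m r) = missing n r \<union> {i \<in> {1..n}. i < m}"
  by (auto simp: missing_def cut_below_def)

lemma max_missing_cut_below:
  assumes "m \<le> max_missing n r"
  shows "max_missing n (cut_below m r) = max_missing n r"
proof (rule antisym)
  show "max_missing n (cut_below m r) \<le> max_missing n r"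
    unfolding max_missing_def[of n "cut_below m r"] missing_cut_below
  proof (rule Max.boundedI)
    fix i assume "i \<in> insert 0 (missing n r \<union> {i \<in> {1..n}. i < m})"
    then consider "i \<in> insert 0 (missing n r)" | "i < m" by auto
    then show "i \<le> max_missing n r"
      by cases (use assms in \<open>auto simp: max_missing_def intro: Max_ge\<close>)
  qed simp_all
  show "max_missing n r \<le> max_missing n (cut_below m r)"
    unfolding max_missing_def missing_cut_below by (intro Max_mono) auto
qed

text \<open>A cut at m adds only missing letters below m, so the largest missing letter stays the
  same, and the cut there subsumes the first.\<close>

lemma stell_map_cut_below:
  "m \<le> max_missing n r \<Longrightarrow> stell_map n (cut_below m r) = stell_map n r"
  by (auto simp: stell_map_eq max_missing_cut_below) (auto simp: cut_below_def)

lemma stell_map_idem: "stell_map n (stell_map n r) = stell_map n r"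
  using stell_map_cut_below[of "max_missing n r" n r] by (simp add: stell_map_eq)

text \<open>Replacing small letters by 0 is weakly increasing, and exchanging letters that have
  become equal has no effect.\<close>

lemma gen_act_cut_below: "k < length r \<Longrightarrow> gen_act (cut_below m r) k = cut_below m (gen_act r k)"
proof (erule gen_cases)
  fix xs a b ys assume "k = Suc (length xs)" "r = xs @ a # b # ys"
  then show ?thesis
    using gen_act_split[of "cut_below m xs"] gen_act_split[of xs a b ys]
    by (auto simp: cut_below_def)
qed (auto simp: cut_below_def gen_act_zero)

lemma stell_map_gen_act:
  assumes "k < length r"
  shows "stell_map n (gen_act (stell_map n r) k) = stell_map n (gen_act r k)"
proof -
  have "missing n r \<subseteq> missing n (gen_act r k)"
    using set_gen_act[OF assms] by (auto simp: missing_def)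
  then have "max_missing n r \<le> max_missing n (gen_act r k)"
    unfolding max_missing_def by (intro Max_mono) auto
  then show ?thesis
    unfolding stell_map_eq[of n r] gen_act_cut_below[OF assms] by (rule stell_map_cut_below)
qed

lemma length_stell_map [simp]: "length (stell_map n r) = length r"
  by (simp add: stell_map_eq cut_below_def)

lemma stell_map_word_act:
  "w \<in> lists {..<length r} \<Longrightarrow> stell_map n (word_act (stell_map n r) w) = stell_map n (word_act r w)"
proof (induction w rule: rev_induct)
  case Nil
  then show ?case by (simp add: word_act_def stell_map_idem)
next
  case (snoc k w)
  then have IH: "stell_map n (word_act (stell_map n r) w) = stell_map n (word_act r w)" and k: "k < length r"
    by simp_all
  have "stell_map n (gen_act (word_act (stell_map n r) w) k) = stell_map n (gen_act (word_act r w) k)"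
    using stell_map_gen_act[of k "word_act (stell_map n r) w" n] stell_map_gen_act[of k "word_act r w" n] IH k
    by simp
  then show ?case by (simp add: word_act_snoc)
qed

lemma distinct_nz_cut_below: "distinct_nz r \<Longrightarrow> distinct_nz (cut_below m r)"
  by (induction r) (auto simp: cut_below_def)

lemma stell_map_rooks: "r \<in> rooks n \<Longrightarrow> stell_map n r \<in> rooks n"
  using distinct_nz_cut_below[of r "max_missing n r"]
  by (auto simp: rooks_iff stell_map_eq) (auto simp: cut_below_def)

text \<open>The transposed form of \<^const>\<open>stell_map\<close>: erases everything up to the last zero.\<close>

fun clear_prefix :: "nat list \<Rightarrow> nat list" where
  "clear_prefix [] = []"
| "clear_prefix (x # xs) = (if 0 \<in> set xs then 0 # clear_prefix xs else x # xs)"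

lemma length_clear_prefix [simp]: "length (clear_prefix q) = length q"
  by (induction q) auto

lemma zero_in_clear_prefix [simp]: "0 \<in> set (clear_prefix q) \<longleftrightarrow> 0 \<in> set q"
  by (induction q) auto

lemma clear_prefix_idem [simp]: "clear_prefix (clear_prefix q) = clear_prefix q"
  by (induction q) auto

lemma clear_prefix_id: "0 \<notin> set q \<Longrightarrow> clear_prefix q = q"
  by (induction q) auto

lemma clear_prefix_append:
  "clear_prefix (xs @ ys) =
    (if 0 \<in> set ys then replicate (length xs) 0 @ clear_prefix ys else clear_prefix xs @ ys)"
  by (induction xs) (auto simp: clear_prefix_id)

lemma clear_prefix_replicate [simp]: "clear_prefix (replicate m 0) = replicate m 0"
  by (induction m) auto

text \<open>A move never takes the last zero to the left, so whatever it does to the part already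
  cleared is cleared again afterwards.\<close>

lemma clear_prefix_gen_act:
  assumes "k < length q"
  shows "clear_prefix (gen_act (clear_prefix q) k) = clear_prefix (gen_act q k)"
  using assms
proof (cases rule: gen_cases)
  case (zero x xs)
  then show ?thesis by (simp add: gen_act_zero)
next
  case (swap xs a b ys)
  note split = gen_act_split[of "replicate (length xs) 0"] gen_act_split[of "clear_prefix xs"]
  show ?thesis
  proof (cases "0 \<in> set ys")
    case True
    then show ?thesis
      using split(1)[of 0 0 "clear_prefix ys"] by (auto simp: swap gen_act_split clear_prefix_append)
  next
    case False
    then show ?thesis
      using split(1)[of 0 b ys] split(1)[of 0 0 ys] split(2)[of a b ys]
      by (cases "b = 0"; cases "a = 0") (auto simp: swap gen_act_split clear_prefix_append)
  qed
qed

lemma clear_prefix_word_act: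
  "w \<in> lists {..<length q} \<Longrightarrow> clear_prefix (word_act (clear_prefix q) w) = clear_prefix (word_act q w)"
proof (induction w rule: rev_induct)
  case Nil
  then show ?case by (simp add: word_act_def)
next
  case (snoc k w)
  then have IH: "clear_prefix (word_act (clear_prefix q) w) = clear_prefix (word_act q w)" and k: "k < length q"
    by simp_all
  have "clear_prefix (gen_act (word_act (clear_prefix q) w) k) = clear_prefix (gen_act (word_act q w) k)"
    using clear_prefix_gen_act[of k "word_act (clear_prefix q) w"] clear_prefix_gen_act[of k "word_act q w"] IH k
    by simp
  then show ?case by (simp add: word_act_snoc)
qed

text \<open>Here m is the position of the last zero counted from 1, or 0 if there is none.\<close>

lemma clear_prefix_eq:
  assumes "m \<le> length q" "\<And>p. m \<le> p \<Longrightarrow> p < length q \<Longrightarrow> q ! p \<noteq> 0" "m = 0 \<or> q ! (m - 1) = 0"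
  shows "clear_prefix q = replicate m 0 @ drop m q"
  using assms
proof (induction q arbitrary: m)
  case (Cons x xs)
  show ?case
  proof (cases m)
    case 0
    then have "0 \<notin> set (x # xs)" using Cons.prems(2) by (metis in_set_conv_nth le0)
    then show ?thesis using 0 clear_prefix_id by fastforce
  next
    case (Suc m')
    have IH: "clear_prefix xs = replicate m' 0 @ drop m' xs" if "m' = 0 \<or> xs ! (m' - 1) = 0"
      using Cons.prems(1) Cons.prems(2)[of "Suc _"] that by (intro Cons.IH) (auto simp: Suc)
    show ?thesis
    proof (cases m')
      case 0
      then have "0 \<notin> set xs" using Cons.prems(2)[of "Suc _"] Suc by (auto simp: in_set_conv_nth)
      then show ?thesis using 0 Suc Cons.prems(3) by simp
    next
      case (Suc m'')
      then have "xs ! m'' = 0" "m'' < length xs" using Cons.prems \<open>m = Suc m'\<close> by auto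
      then have "0 \<in> set xs" by (metis nth_mem)
      then show ?thesis using IH Suc \<open>m = Suc m'\<close> \<open>xs ! m'' = 0\<close> by simp
    qed
  qed
qed simp

text \<open>The cut raises the threshold j to m. The letter m must be absent because the cut keeps
  it while the threshold drops it. The same change in the row index is
  \<open>dom_count_clear\<close>.\<close>

lemma dom_count_cut_below:
  assumes "m = 0 \<or> m \<notin> set r"
  shows "dom_count (cut_below m r) i j = dom_count r i (max j m)"
proof -
  have "j < (if x < m then 0 else x) \<longleftrightarrow> max j m < x" if "x \<in> set (drop i r)" for x
    using in_set_dropD[OF that] assms by (cases "x = m") auto
  then have "filter (\<lambda>x. j < (if x < m then 0 else x)) (drop i r) = filter (\<lambda>x. max j m < x) (drop i r)"
    by (rule filter_cong[OF HOL.refl])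
  then show ?thesis
    by (simp add: dom_count_def cut_below_def drop_map filter_map comp_def)
qed

lemma dom_count_clear:
  assumes "m \<le> length q"
  shows "dom_count (replicate m 0 @ drop m q) i j = dom_count q (max i m) j"
  using assms by (cases "i \<le> m") (simp_all add: dom_count_def max_def)


lemma dom_count_zero_eq: "dom_count r 0 j = dom_count r 0 (Suc j) + count_list r (Suc j)"
  by (induction r) (auto simp: dom_count_def)

lemma dom_count_nth:
  "p < length q \<Longrightarrow> dom_count q p 0 = dom_count q (Suc p) 0 + (if q ! p = 0 then 0 else 1)"
  by (simp add: dom_count_def Cons_nth_drop_Suc[symmetric])

text \<open>Missing letters of r are the positions of zeros in its transpose q, so the largest
  missing letter is the position of the last zero.\<close>

lemma clear_prefix_transp:
  assumes r: "r \<in> rooks n" and q: "q \<in> rooks n" and tr: "dom_count q = transpose_fun (dom_count r)"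
  shows "dom_count (clear_prefix q) = transpose_fun (dom_count (stell_map n r))"
proof -
  have nth_iff: "q ! p = 0 \<longleftrightarrow> Suc p \<notin> set r" if "p < n" for p
  proof -
    have "dom_count q p 0 = dom_count r 0 p" "dom_count q (Suc p) 0 = dom_count r 0 (Suc p)"
      by (simp_all add: tr transpose_fun_def)
    then have "count_list r (Suc p) = (if q ! p = 0 then 0 else 1)"
      using dom_count_nth[of p q] dom_count_zero_eq[of r p] that q by (simp add: rooks_iff)
    then show ?thesis by (metis count_list_0_iff zero_neq_one)
  qed
  define m where "m = max_missing n r"
  have "m \<in> insert 0 (missing n r)"
    unfolding m_def max_missing_def by (intro Max_in) auto
  then have m: "m = 0 \<or> m \<in> missing n r" by simp
  then have mn: "m \<le> n" by (auto simp: missing_def)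
  have ge: "i \<le> m" if "i \<in> missing n r" for i
    unfolding m_def max_missing_def using that by (intro Max_ge) auto
  have "clear_prefix q = replicate m 0 @ drop m q"
  proof (rule clear_prefix_eq)
    show "m \<le> length q" using mn q by (simp add: rooks_iff)
    show "q ! p \<noteq> 0" if "m \<le> p" "p < length q" for p
      using nth_iff[of p] ge[of "Suc p"] that q by (auto simp: rooks_iff missing_def)
    show "m = 0 \<or> q ! (m - 1) = 0"
      using m mn nth_iff[of "m - 1"] by (cases m) (auto simp: missing_def)
  qed
  moreover have "m = 0 \<or> m \<notin> set r" using m by (auto simp: missing_def)
  ultimately have "dom_count (clear_prefix q) i j = dom_count (stell_map n r) j i" for i j
    using mn q by (simp add: dom_count_clear stell_map_eq m_def[symmetric] dom_count_cut_below tr transpose_fun_def rooks_iff)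
  then show ?thesis by (simp add: fun_eq_iff transpose_fun_def)
qed

lemma clear_prefix_rev_word:
  assumes "w \<in> lists {..<n}" "w' \<in> lists {..<n}"
    and "word_act (id_rook n) w' = stell_map n (word_act (id_rook n) w)"
  shows "word_act (id_rook n) (rev w') = clear_prefix (word_act (id_rook n) (rev w))"
proof (rule dom_count_inj)
  have "rev w \<in> lists {..<n}" using assms(1) by auto
  then show "dom_count (word_act (id_rook n) (rev w')) = dom_count (clear_prefix (word_act (id_rook n) (rev w)))"
    using assms id_rook_rooks
    by (simp add: dom_count_rev clear_prefix_transp[of "word_act (id_rook n) w" n] word_act_rooks)
qed simp

lemma clear_prefix_split:
  obtains p s where "q = p @ s" "clear_prefix q = replicate (length p) 0 @ s" "0 \<notin> set s"
proof -
  have "\<exists>p s. q = p @ s \<and> clear_prefix q = replicate (length p) 0 @ s \<and> 0 \<notin> set s"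
  proof (induction q)
    case (Cons x q)
    then obtain p s where *: "q = p @ s" "clear_prefix q = replicate (length p) 0 @ s" "0 \<notin> set s" by blast
    show ?case
    proof (cases "0 \<in> set q")
      case True
      with * show ?thesis by (intro exI[of _ "x # p"] exI[of _ s]) simp
    next
      case False
      show ?thesis
      proof (cases "x = 0")
        case True
        with False show ?thesis by (intro exI[of _ "[0]"] exI[of _ q]) simp
      next
        case x: False
        with False show ?thesis by (intro exI[of _ "[]"] exI[of _ "x # q"]) simp
      qed
    qed
  qed simp
  with that show ?thesis by blast
qed

lemma distinct_nz_replicate [simp]: "distinct_nz (replicate m 0)"
  by (induction m) auto

lemma zeros_after_no_zero: "0 \<notin> set s \<Longrightarrow> zeros_after s b = 0"
  using zeros_after_le_count[of s b] by (simp add: count_list_0_iff)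

text \<open>The surviving nonzero letters stand behind the last zero, and neither their inversions
  nor their zero counts change.\<close>

lemma reach_clear_prefix:
  assumes "distinct_nz q"
  shows "reach q (clear_prefix q)"
proof -
  obtain p s where q: "q = p @ s" "clear_prefix q = replicate (length p) 0 @ s" "0 \<notin> set s"
    by (rule clear_prefix_split)
  have "rook_le (replicate (length p) 0 @ s) (p @ s)"
    unfolding rook_le_def
  proof (intro ballI impI conjI allI)
    fix b assume "b \<in> set (replicate (length p) 0 @ s)" "b \<noteq> 0"
    then have b: "b \<in> set s" "b \<noteq> 0" by auto
    then have "b \<notin> set p" using assms q(1) by auto
    show "b \<in> set (p @ s)" using b by simp
    show "zeros_after (p @ s) b \<le> zeros_after (replicate (length p) 0 @ s) b"
      using \<open>b \<notin> set p\<close> q(3) by (simp add: zeros_after_append zeros_after_no_zero)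
    show "precedes (replicate (length p) 0 @ s) b a" if "0 < a \<and> a < b \<and> precedes (p @ s) b a" for a
      using that \<open>b \<notin> set p\<close> by (auto simp: precedes_append dest: precedes_set)
  qed
  then have "reach q (replicate (length p) 0 @ s)"
    using assms q(1) by (intro reach_of_rook_le) auto
  then show ?thesis by (simp only: q(2))
qed

text \<open>The least stellar element above \<open>q\<close>, in transposed form.\<close>

definition zeros_first :: "nat list \<Rightarrow> nat list" where
  "zeros_first q = replicate (count_list q 0) 0 @ filter (\<lambda>x. x \<noteq> 0) q"

lemma set_zeros_first [simp]: "set (zeros_first q) = set q"
  by (auto simp: zeros_first_def count_list_0_iff intro!: gr0I)

lemma length_zeros_first [simp]: "length (zeros_first q) = length q"
proof -
  have "count_list q 0 + length (filter (\<lambda>x. x \<noteq> 0) q) = length q" by (induction q) auto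
  then show ?thesis by (simp add: zeros_first_def)
qed

lemma distinct_nz_zeros_first: "distinct_nz q \<Longrightarrow> distinct_nz (zeros_first q)"
  by (auto simp: zeros_first_def) (simp add: distinct_nz_def)

lemma zeros_first_rooks: "q \<in> rooks n \<Longrightarrow> zeros_first q \<in> rooks n"
  by (simp add: rooks_iff distinct_nz_zeros_first)

lemma precedes_zeros_first:
  assumes "b \<noteq> 0" "a \<noteq> 0"
  shows "precedes (zeros_first q) b a \<longleftrightarrow> precedes q b a"
proof -
  have "precedes (filter (\<lambda>x. x \<noteq> 0) q) b a \<longleftrightarrow> precedes q b a"
    using assms by (induction q) auto
  then show ?thesis
    using assms by (auto simp: zeros_first_def precedes_append dest: precedes_set split: if_splits)
qed

lemma zeros_after_zeros_first: "b \<noteq> 0 \<Longrightarrow> zeros_after (zeros_first q) b = 0"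
  by (simp add: zeros_first_def zeros_after_append zeros_after_no_zero)

text \<open>Inversions of nonzero letters are kept, and no such letter has a zero on its right any
  more, so the conditions on q only become weaker.\<close>

lemma rook_le_zeros_first: "rook_le q (zeros_first q)"
  by (auto simp: rook_le_def zeros_after_zeros_first precedes_zeros_first)

lemma rook_le_zeros_first_mono: "rook_le z q \<Longrightarrow> rook_le (zeros_first z) (zeros_first q)"
  by (auto simp: rook_le_def zeros_after_zeros_first precedes_zeros_first)

lemma clear_prefix_zeros_first: "clear_prefix (zeros_first q) = zeros_first q"
  by (simp add: zeros_first_def clear_prefix_append clear_prefix_id)

text \<open>With \<open>clear_prefix_zeros_first\<close>, the interior and the closure operator have
  the same fixed points.\<close>

lemma zeros_first_clear_prefix:
  assumes "clear_prefix q = q"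
  shows "zeros_first q = q"
proof -
  obtain p s where q: "q = p @ s" "clear_prefix q = replicate (length p) 0 @ s" "0 \<notin> set s"
    by (rule clear_prefix_split)
  have "count_list (replicate m 0) 0 = m" for m by (induction m) auto
  moreover have "filter (\<lambda>x. x \<noteq> 0) s = s" using q(3) by (auto simp: filter_id_conv intro!: gr0I)
  moreover have "count_list s 0 = 0" using q(3) by simp
  moreover have "filter (\<lambda>x. x \<noteq> 0) (replicate m (0::nat)) = []" for m by simp
  ultimately have "zeros_first (replicate (length p) 0 @ s) = replicate (length p) 0 @ s"
    by (simp add: zeros_first_def)
  then show ?thesis using assms q by metis
qed

text \<open>An upper bound j of least height works: the meet of j with any other upper bound is
  again an upper bound below j, hence equal to j.\<close>

lemma ex_join:
  assumes "x \<in> rooks n" "y \<in> rooks n"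
  shows "\<exists>j\<in>rooks n. reach j x \<and> reach j y \<and> (\<forall>z\<in>rooks n. reach z x \<and> reach z y \<longrightarrow> reach z j)"
proof -
  define U where "U = {z \<in> rooks n. reach z x \<and> reach z y}"
  have "id_rook n \<in> U" using assms reach_id_rook id_rook_rooks by (simp add: U_def)
  then obtain j where j: "j \<in> U" and min: "\<And>z. z \<in> U \<Longrightarrow> rook_height j \<le> rook_height z"
    using ex_has_least_nat[of "\<lambda>z. z \<in> U" "id_rook n" rook_height] by blast
  have "reach z j" if z: "z \<in> rooks n" "reach z x" "reach z y" for z
  proof -
    have "distinct_nz (id_rook n)" using id_rook_rooks by (simp add: rooks_iff)
    moreover have "reach (id_rook n) z" "reach (id_rook n) j"
      using z j by (simp_all add: reach_id_rook U_def)
    ultimately obtain m where m: "is_meet z j m" using ex_meet by blast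
    then have "reach m x" "reach m y" "reach j m" "reach z m"
      using z j by (auto simp: is_meet_def U_def)
    moreover have "m \<in> rooks n"
      using \<open>reach z m\<close> z(1) word_act_rooks by (auto simp: reach_def rooks_iff)
    ultimately have "m \<in> U" by (simp add: U_def)
    then have "m = j" using min[of m] reach_height[OF \<open>reach j m\<close>] by auto
    with \<open>reach z m\<close> show ?thesis by simp
  qed
  with j show ?thesis unfolding U_def by blast
qed

section \<open>The order of the 0-rook monoid and its stellar quotient\<close>

lemma (in monoid) left_ideal_subset_iff:
  assumes "x \<in> carrier G" "y \<in> carrier G"
  shows "carrier G #> x \<subseteq> carrier G #> y \<longleftrightarrow> (\<exists>m\<in>carrier G. x = m \<otimes> y)"
proof
  assume "carrier G #> x \<subseteq> carrier G #> y"
  moreover have "\<one> \<otimes> x \<in> carrier G #> x" unfolding r_coset_def by blast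
  ultimately show "\<exists>m\<in>carrier G. x = m \<otimes> y" using assms by (auto simp: r_coset_def)
next
  assume "\<exists>m\<in>carrier G. x = m \<otimes> y"
  then obtain m where m: "m \<in> carrier G" "x = m \<otimes> y" by blast
  have "h \<otimes> x = (h \<otimes> m) \<otimes> y" if "h \<in> carrier G" for h
    using m assms that by (simp add: m_assoc)
  then show "carrier G #> x \<subseteq> carrier G #> y"
    using m(1) unfolding r_coset_def by blast
qed

section \<open>Elements of the monoid as transposed rooks\<close>

definition word_class :: "nat \<Rightarrow> nat list \<Rightarrow> nat list set" where
  "word_class n w = word_cong {..<n} (rook_rels n) `` {w}"

lemma rook0_carrier: "carrier (rook0_monoid n) = word_class n ` lists {..<n}"
  by (auto simp: rook0_monoid_def presented_monoid_def quotient_def word_class_def)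

lemma rook0_carrierE:
  assumes "x \<in> carrier (rook0_monoid n)"
  obtains w where "w \<in> lists {..<n}" "x = word_class n w"
  using assms unfolding rook0_carrier by blast

lemma word_class_carrier: "w \<in> lists {..<n} \<Longrightarrow> word_class n w \<in> carrier (rook0_monoid n)"
  unfolding rook0_carrier by (rule imageI)

lemma rook0_mult:
  "u \<in> lists {..<n} \<Longrightarrow> v \<in> lists {..<n} \<Longrightarrow>
    word_class n u \<otimes>\<^bsub>rook0_monoid n\<^esub> word_class n v = word_class n (u @ v)"
  unfolding rook0_monoid_def word_class_def by (rule presented_monoid_mult)

lemma monoid_rook0: "monoid (rook0_monoid n)"
  unfolding rook0_monoid_def by (rule monoid_presented_monoid)

lemma word_class_eq_iff:
  assumes "u \<in> lists {..<n}" "v \<in> lists {..<n}"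
  shows "word_class n u = word_class n v \<longleftrightarrow> word_act (id_rook n) u = word_act (id_rook n) v"
  unfolding word_class_def rook_cong_iff[OF assms, symmetric]
  using eq_equiv_class_iff[OF equiv_word_cong assms] by simp

lemma mem_word_class: "w \<in> lists {..<n} \<Longrightarrow> w \<in> word_class n w"
  by (simp add: word_class_def word_cong.refl)

lemma rook_act_word_class:
  "w \<in> lists {..<n} \<Longrightarrow> rook_act (id_rook n) (word_class n w) = word_act (id_rook n) w"
  by (rule rook_act_eq) (simp_all add: rook0_carrier mem_word_class)

lemma rook_elt_eq:
  assumes "w \<in> lists {..<n}" "word_act (id_rook n) w = r"
  shows "rook_elt n r = word_class n w"
  unfolding rook_elt_def
proof (rule the_equality)
  show "word_class n w \<in> carrier (rook0_monoid n) \<and> rook_act (id_rook n) (word_class n w) = r"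
    using assms by (simp add: rook0_carrier rook_act_word_class)
  fix x assume x: "x \<in> carrier (rook0_monoid n) \<and> rook_act (id_rook n) x = r"
  then obtain v where "v \<in> lists {..<n}" "x = word_class n v" by (auto simp: rook0_carrier)
  with x assms show "x = word_class n w"
    by (simp add: word_class_eq_iff rook_act_word_class)
qed

text \<open>Representing \<open>\<pi>\<^sub>r\<close> by the transpose of \<open>r\<close> turns left multiplication into the right action.\<close>

definition dual_rook :: "nat \<Rightarrow> nat list set \<Rightarrow> nat list" where
  "dual_rook n x = word_act (id_rook n) (rev (SOME w. w \<in> x))"

lemma dual_rook_word_class:
  assumes "w \<in> lists {..<n}"
  shows "dual_rook n (word_class n w) = word_act (id_rook n) (rev w)"
proof -
  have "(SOME v. v \<in> word_class n w) \<in> word_class n w"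
    using mem_word_class[OF assms] by (rule someI)
  then have *: "rook_cong n w (SOME v. v \<in> word_class n w)"
    by (simp add: word_class_def)
  then have "(SOME v. v \<in> word_class n w) \<in> lists {..<n}"
    using word_cong_lists by blast
  moreover have "word_act (id_rook n) (SOME v. v \<in> word_class n w) = word_act (id_rook n) w"
    using word_act_cong[OF *, of "id_rook n"] by simp
  ultimately show ?thesis
    using word_act_rev_eq_iff[OF _ assms] by (simp add: dual_rook_def)
qed

lemma dual_rook_inj:
  assumes "x \<in> carrier (rook0_monoid n)" "y \<in> carrier (rook0_monoid n)" "dual_rook n x = dual_rook n y"
  shows "x = y"
proof -
  obtain u v where "u \<in> lists {..<n}" "x = word_class n u" "v \<in> lists {..<n}" "y = word_class n v"
    using assms(1,2) by (elim rook0_carrierE)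
  then show ?thesis
    using assms(3) dual_rook_word_class word_act_rev_eq_iff word_class_eq_iff by metis
qed

lemma rev_lists: "w \<in> lists A \<Longrightarrow> rev w \<in> lists A"
  by auto

lemma dual_rook_rooks: "x \<in> carrier (rook0_monoid n) \<Longrightarrow> dual_rook n x \<in> rooks n"
  by (elim rook0_carrierE) (metis dual_rook_word_class word_act_rooks id_rook_rooks rev_lists)

lemma ex_dual_rook:
  assumes "r \<in> rooks n"
  obtains x where "x \<in> carrier (rook0_monoid n)" "dual_rook n x = r"
proof -
  obtain w where "w \<in> lists {..<n}" "word_act (id_rook n) w = r"
    using ex_word assms by blast
  then show ?thesis
    using that[of "word_class n (rev w)"] word_class_carrier dual_rook_word_class rev_lists
    by (metis rev_rev_ident)
qed

lemma dual_rook_mult: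
  assumes "u \<in> lists {..<n}" "y \<in> carrier (rook0_monoid n)"
  shows "dual_rook n (word_class n u \<otimes>\<^bsub>rook0_monoid n\<^esub> y) = word_act (dual_rook n y) (rev u)"
proof -
  obtain v where v: "v \<in> lists {..<n}" "y = word_class n v"
    using assms(2) by (rule rook0_carrierE)
  then have "u @ v \<in> lists {..<n}" using assms(1) by simp
  then show ?thesis
    using assms(1) v by (simp only: rook0_mult dual_rook_word_class rev_append word_act_append)
qed

lemma length_dual_rook: "x \<in> carrier (rook0_monoid n) \<Longrightarrow> length (dual_rook n x) = n"
  using dual_rook_rooks by (simp add: rooks_iff)

lemma L_order_rook0_iff:
  assumes "x \<in> carrier (rook0_monoid n)" "y \<in> carrier (rook0_monoid n)"
  shows "x \<sqsubseteq>\<^bsub>L_order (rook0_monoid n)\<^esub> y \<longleftrightarrow> reach (dual_rook n y) (dual_rook n x)"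
proof -
  have "x \<sqsubseteq>\<^bsub>L_order (rook0_monoid n)\<^esub> y \<longleftrightarrow>
      (\<exists>m\<in>carrier (rook0_monoid n). x = m \<otimes>\<^bsub>rook0_monoid n\<^esub> y)"
    unfolding L_order_def using monoid.left_ideal_subset_iff[OF monoid_rook0 assms] by simp
  also have "\<dots> \<longleftrightarrow> (\<exists>u\<in>lists {..<n}. x = word_class n u \<otimes>\<^bsub>rook0_monoid n\<^esub> y)"
    by (auto simp: rook0_carrier)
  also have "\<dots> \<longleftrightarrow> (\<exists>u\<in>lists {..<n}. dual_rook n x = word_act (dual_rook n y) (rev u))"
  proof (intro bex_cong HOL.refl)
    fix u assume u: "u \<in> lists {..<n}"
    then have "word_class n u \<otimes>\<^bsub>rook0_monoid n\<^esub> y \<in> carrier (rook0_monoid n)"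
      using assms(2) by (intro monoid.m_closed[OF monoid_rook0]) (auto simp: rook0_carrier)
    then show "x = word_class n u \<otimes>\<^bsub>rook0_monoid n\<^esub> y \<longleftrightarrow> dual_rook n x = word_act (dual_rook n y) (rev u)"
      using dual_rook_inj[OF assms(1)] dual_rook_mult[OF u assms(2)] by metis
  qed
  also have "\<dots> \<longleftrightarrow> reach (dual_rook n y) (dual_rook n x)"
    unfolding reach_def length_dual_rook[OF assms(2)] by (metis rev_lists rev_rev_ident)
  finally show ?thesis .
qed

lemma L_order_simps [simp]:
  "carrier (L_order M) = carrier M" "x .=\<^bsub>L_order M\<^esub> y \<longleftrightarrow> x = y"
  by (simp_all add: L_order_def)

lemma lattice_L_order_rook0: "lattice (L_order (rook0_monoid n))"
proof -
  let ?M = "rook0_monoid n" and ?L = "L_order (rook0_monoid n)"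
  have po: "partial_order ?L"
  proof
    show "x \<sqsubseteq>\<^bsub>?L\<^esub> x" if "x \<in> carrier ?L" for x
      using that by (simp add: L_order_rook0_iff reach_refl)
    show "x .=\<^bsub>?L\<^esub> y" if "x \<sqsubseteq>\<^bsub>?L\<^esub> y" "y \<sqsubseteq>\<^bsub>?L\<^esub> x" "x \<in> carrier ?L" "y \<in> carrier ?L" for x y
      using that dual_rook_inj[of x n y] reach_antisym[of "dual_rook n x" "dual_rook n y"]
      by (simp add: L_order_rook0_iff)
    show "x \<sqsubseteq>\<^bsub>?L\<^esub> z" if "x \<sqsubseteq>\<^bsub>?L\<^esub> y" "y \<sqsubseteq>\<^bsub>?L\<^esub> z" "x \<in> carrier ?L" "y \<in> carrier ?L" "z \<in> carrier ?L"
      for x y z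
      using that reach_trans[of "dual_rook n z" "dual_rook n y" "dual_rook n x"]
      by (simp add: L_order_rook0_iff)
  qed (auto simp: fun_eq_iff)
  show ?thesis
  proof (intro lattice.intro upper_semilattice.intro lower_semilattice.intro po
      upper_semilattice_axioms.intro lower_semilattice_axioms.intro)
    fix x y assume "x \<in> carrier ?L" "y \<in> carrier ?L"
    then have xy: "x \<in> carrier ?M" "y \<in> carrier ?M" by simp_all
    obtain j where j: "j \<in> rooks n" "reach j (dual_rook n x)" "reach j (dual_rook n y)"
      "\<forall>z\<in>rooks n. reach z (dual_rook n x) \<and> reach z (dual_rook n y) \<longrightarrow> reach z j"
      using ex_join[OF dual_rook_rooks[OF xy(1)] dual_rook_rooks[OF xy(2)]] by (elim bexE conjE)
    obtain s where s: "s \<in> carrier ?M" "dual_rook n s = j" using ex_dual_rook j(1) by blast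
    have "s \<sqsubseteq>\<^bsub>?L\<^esub> z" if "z \<in> carrier ?M" "x \<sqsubseteq>\<^bsub>?L\<^esub> z" "y \<sqsubseteq>\<^bsub>?L\<^esub> z" for z
      using that xy s bspec[OF j(4) dual_rook_rooks[OF that(1)]] by (simp add: L_order_rook0_iff)
    moreover have "x \<sqsubseteq>\<^bsub>?L\<^esub> s" "y \<sqsubseteq>\<^bsub>?L\<^esub> s"
      using xy s j(2,3) by (simp_all add: L_order_rook0_iff)
    ultimately have "least ?L s (Upper ?L {x, y})"
      using xy s(1) by (auto simp: least_def Upper_def)
    then show "\<exists>s. least ?L s (Upper ?L {x, y})" by blast
  next
    fix x y assume "x \<in> carrier ?L" "y \<in> carrier ?L"
    then have xy: "x \<in> carrier ?M" "y \<in> carrier ?M" by simp_all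
    have "distinct_nz (id_rook n)" using id_rook_rooks by (simp add: rooks_iff)
    then obtain m where m: "is_meet (dual_rook n x) (dual_rook n y) m"
      using ex_meet reach_id_rook[OF dual_rook_rooks[OF xy(1)]] reach_id_rook[OF dual_rook_rooks[OF xy(2)]]
      by blast
    then have "reach (dual_rook n x) m" by (simp add: is_meet_def)
    then have "m \<in> rooks n"
      using word_act_rooks[OF dual_rook_rooks[OF xy(1)]] unfolding reach_def length_dual_rook[OF xy(1)]
      by blast
    then obtain s where s: "s \<in> carrier ?M" "dual_rook n s = m" using ex_dual_rook by blast
    have "z \<sqsubseteq>\<^bsub>?L\<^esub> s" if "z \<in> carrier ?M" "z \<sqsubseteq>\<^bsub>?L\<^esub> x" "z \<sqsubseteq>\<^bsub>?L\<^esub> y" for z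
      using that xy s m by (simp add: L_order_rook0_iff is_meet_def)
    moreover have "s \<sqsubseteq>\<^bsub>?L\<^esub> x" "s \<sqsubseteq>\<^bsub>?L\<^esub> y"
      using xy s m by (simp_all add: L_order_rook0_iff is_meet_def)
    ultimately have "greatest ?L s (Lower ?L {x, y})"
      using xy s(1) by (auto simp: greatest_def Lower_def)
    then show "\<exists>s. greatest ?L s (Lower ?L {x, y})" by blast
  qed
qed

section \<open>The stellar monoid as a quotient\<close>

lemma stell0_map_word_class:
  assumes "w \<in> lists {..<n}"
  obtains w' where "w' \<in> lists {..<n}" "word_act (id_rook n) w' = stell_map n (word_act (id_rook n) w)"
    "stell0_map n (word_class n w) = word_class n w'"
proof -
  have "stell_map n (word_act (id_rook n) w) \<in> rooks n"
    using assms by (intro stell_map_rooks word_act_rooks id_rook_rooks)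
  then obtain w' where "w' \<in> lists {..<n}" "word_act (id_rook n) w' = stell_map n (word_act (id_rook n) w)"
    using ex_word by blast
  moreover from this have "stell0_map n (word_class n w) = word_class n w'"
    unfolding stell0_map_def rook_act_word_class[OF assms] by (rule rook_elt_eq)
  ultimately show ?thesis using that by blast
qed

lemma stell0_map_closed: "x \<in> carrier (rook0_monoid n) \<Longrightarrow> stell0_map n x \<in> carrier (rook0_monoid n)"
  by (metis rook0_carrierE stell0_map_word_class word_class_carrier)

lemma dual_rook_stell0_map:
  assumes "x \<in> carrier (rook0_monoid n)"
  shows "dual_rook n (stell0_map n x) = clear_prefix (dual_rook n x)"
proof -
  obtain w where w: "w \<in> lists {..<n}" "x = word_class n w" using assms by (rule rook0_carrierE)
  obtain w' where w': "w' \<in> lists {..<n}" "word_act (id_rook n) w' = stell_map n (word_act (id_rook n) w)"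
    "stell0_map n (word_class n w) = word_class n w'"
    using w(1) by (rule stell0_map_word_class)
  show ?thesis
    unfolding w(2) w'(3) dual_rook_word_class[OF w(1)] dual_rook_word_class[OF w'(1)]
    by (rule clear_prefix_rev_word[OF w(1) w'(1,2)])
qed

lemma stell0_map_idem:
  "x \<in> carrier (rook0_monoid n) \<Longrightarrow> stell0_map n (stell0_map n x) = stell0_map n x"
  by (rule dual_rook_inj[of _ n]) (simp_all add: stell0_map_closed dual_rook_stell0_map)

text \<open>The two halves of the congruence use different models: left factors act on transposed
  rooks, where \<open>clear_prefix_word_act\<close> applies, and right factors act on rooks, where
  \<open>stell_map_word_act\<close> does.\<close>

lemma stell0_map_mult_right:
  assumes "x \<in> carrier (rook0_monoid n)" "y \<in> carrier (rook0_monoid n)"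
  shows "stell0_map n (x \<otimes>\<^bsub>rook0_monoid n\<^esub> stell0_map n y) = stell0_map n (x \<otimes>\<^bsub>rook0_monoid n\<^esub> y)"
proof (rule dual_rook_inj)
  let ?M = "rook0_monoid n"
  interpret M: monoid ?M by (rule monoid_rook0)
  have sy: "stell0_map n y \<in> carrier ?M" using assms(2) by (rule stell0_map_closed)
  show "stell0_map n (x \<otimes>\<^bsub>?M\<^esub> stell0_map n y) \<in> carrier ?M" "stell0_map n (x \<otimes>\<^bsub>?M\<^esub> y) \<in> carrier ?M"
    using assms sy by (simp_all add: stell0_map_closed)
  obtain u where u: "u \<in> lists {..<n}" "x = word_class n u" using assms(1) by (rule rook0_carrierE)
  have "dual_rook n (stell0_map n (x \<otimes>\<^bsub>?M\<^esub> stell0_map n y)) =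
      clear_prefix (word_act (clear_prefix (dual_rook n y)) (rev u))"
    using assms sy by (simp add: dual_rook_stell0_map u(2) dual_rook_mult[OF u(1)])
  also have "\<dots> = clear_prefix (word_act (dual_rook n y) (rev u))"
    using rev_lists[OF u(1)] by (intro clear_prefix_word_act) (simp add: length_dual_rook[OF assms(2)])
  also have "\<dots> = dual_rook n (stell0_map n (x \<otimes>\<^bsub>?M\<^esub> y))"
    using assms by (simp add: dual_rook_stell0_map u(2) dual_rook_mult[OF u(1)])
  finally show "dual_rook n (stell0_map n (x \<otimes>\<^bsub>?M\<^esub> stell0_map n y)) =
      dual_rook n (stell0_map n (x \<otimes>\<^bsub>?M\<^esub> y))" .
qed

lemma stell0_map_mult_left:
  assumes "x \<in> carrier (rook0_monoid n)" "y \<in> carrier (rook0_monoid n)"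
  shows "stell0_map n (stell0_map n x \<otimes>\<^bsub>rook0_monoid n\<^esub> y) = stell0_map n (x \<otimes>\<^bsub>rook0_monoid n\<^esub> y)"
proof -
  obtain u where u: "u \<in> lists {..<n}" "x = word_class n u" using assms(1) by (rule rook0_carrierE)
  obtain v where v: "v \<in> lists {..<n}" "y = word_class n v" using assms(2) by (rule rook0_carrierE)
  obtain u' where u': "u' \<in> lists {..<n}" "word_act (id_rook n) u' = stell_map n (word_act (id_rook n) u)"
    "stell0_map n (word_class n u) = word_class n u'"
    using u(1) by (rule stell0_map_word_class)
  have "stell_map n (word_act (id_rook n) (u' @ v)) = stell_map n (word_act (id_rook n) (u @ v))"
    unfolding word_act_append u'(2) using v(1) by (intro stell_map_word_act) simp
  moreover have "u @ v \<in> lists {..<n}" "u' @ v \<in> lists {..<n}" using u v u' by simp_all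
  ultimately show ?thesis
    unfolding u(2) v(2) u'(3) rook0_mult[OF u(1) v(1)] rook0_mult[OF u'(1) v(1)]
    by (simp only: stell0_map_def rook_act_word_class)
qed

lemma stell_carrier_eq: "stell_carrier n = stell0_map n ` carrier (rook0_monoid n)"
proof -
  have "rook_act (id_rook n) ` carrier (rook0_monoid n) = rooks n"
  proof (intro equalityI subsetI)
    fix r assume "r \<in> rooks n"
    then obtain w where "w \<in> lists {..<n}" "word_act (id_rook n) w = r" using ex_word by blast
    then show "r \<in> rook_act (id_rook n) ` carrier (rook0_monoid n)"
      by (metis rook_act_word_class word_class_carrier imageI)
  next
    fix r assume "r \<in> rook_act (id_rook n) ` carrier (rook0_monoid n)"
    then obtain x where "x \<in> carrier (rook0_monoid n)" "r = rook_act (id_rook n) x" by blast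
    then show "r \<in> rooks n"
      by (metis rook0_carrierE rook_act_word_class word_act_rooks id_rook_rooks)
  qed
  then show ?thesis
    by (simp add: stell_carrier_def stell_rooks_def stell0_map_def image_image flip: \<open>_ = rooks n\<close>)
qed

lemma stell0_monoid_props:
  shows "monoid (stell0_monoid n)" and "carrier (stell0_monoid n) = stell_carrier n"
    and "stell0_map n \<in> hom (rook0_monoid n) (stell0_monoid n)"
proof -
  let ?M = "rook0_monoid n"
  let ?P = "\<lambda>G. monoid G \<and> carrier G = stell_carrier n
        \<and> stell0_map n \<in> hom (rook0_monoid n) G
        \<and> stell0_map n ` carrier (rook0_monoid n) = carrier G
        \<and> stell0_map n \<one>\<^bsub>rook0_monoid n\<^esub> = \<one>\<^bsub>G\<^esub>"
  interpret M: monoid ?M by (rule monoid_rook0)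
  define G where "G = \<lparr>carrier = stell_carrier n,
      mult = (\<lambda>x y. stell0_map n (x \<otimes>\<^bsub>?M\<^esub> y)), one = stell0_map n \<one>\<^bsub>?M\<^esub>\<rparr>"
  note simps = stell0_map_mult_left stell0_map_mult_right stell0_map_idem stell0_map_closed
  have "monoid G"
  proof (rule monoidI)
    fix x y z assume "x \<in> carrier G" "y \<in> carrier G" "z \<in> carrier G"
    then show "x \<otimes>\<^bsub>G\<^esub> y \<otimes>\<^bsub>G\<^esub> z = x \<otimes>\<^bsub>G\<^esub> (y \<otimes>\<^bsub>G\<^esub> z)"
      by (auto simp: G_def stell_carrier_eq simps M.m_assoc)
  qed (auto simp: G_def stell_carrier_eq simps)
  then have "?P G"
    by (auto simp: G_def stell_carrier_eq simps hom_def)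
  then have "?P (stell0_monoid n)"
    unfolding stell0_monoid_def by (rule someI)
  then show "monoid (stell0_monoid n)" "carrier (stell0_monoid n) = stell_carrier n"
    "stell0_map n \<in> hom (rook0_monoid n) (stell0_monoid n)" by blast+
qed

section \<open>Comparison of the two orders\<close>

lemma L_order_stell0_map_le:
  assumes "x \<in> carrier (rook0_monoid n)"
  shows "stell0_map n x \<sqsubseteq>\<^bsub>L_order (rook0_monoid n)\<^esub> x"
  using assms dual_rook_rooks[OF assms]
  by (simp add: L_order_rook0_iff stell0_map_closed dual_rook_stell0_map reach_clear_prefix rooks_iff)

lemma L_order_rook0_iff_mult:
  assumes "x \<in> carrier (rook0_monoid n)" "y \<in> carrier (rook0_monoid n)"
  shows "x \<sqsubseteq>\<^bsub>L_order (rook0_monoid n)\<^esub> y \<longleftrightarrow>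
    (\<exists>m\<in>carrier (rook0_monoid n). x = m \<otimes>\<^bsub>rook0_monoid n\<^esub> y)"
  unfolding L_order_def using monoid.left_ideal_subset_iff[OF monoid_rook0 assms] by simp

text \<open>If x = m y, then St x = St(m St y) \<le> m St y \<le> St y.\<close>

lemma stell0_map_mono:
  assumes "x \<in> carrier (rook0_monoid n)" "y \<in> carrier (rook0_monoid n)"
    and "x \<sqsubseteq>\<^bsub>L_order (rook0_monoid n)\<^esub> y"
  shows "stell0_map n x \<sqsubseteq>\<^bsub>L_order (rook0_monoid n)\<^esub> stell0_map n y"
proof -
  let ?M = "rook0_monoid n" and ?L = "L_order (rook0_monoid n)"
  interpret M: monoid ?M by (rule monoid_rook0)
  interpret L: lattice ?L by (rule lattice_L_order_rook0)
  obtain m where m: "m \<in> carrier ?M" "x = m \<otimes>\<^bsub>?M\<^esub> y"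
    using assms L_order_rook0_iff_mult by blast
  have "stell0_map n x = stell0_map n (m \<otimes>\<^bsub>?M\<^esub> stell0_map n y)"
    using m assms(2) by (simp add: stell0_map_mult_right)
  also have "\<dots> \<sqsubseteq>\<^bsub>?L\<^esub> m \<otimes>\<^bsub>?M\<^esub> stell0_map n y"
    using m(1) assms(2) by (intro L_order_stell0_map_le) (simp add: stell0_map_closed)
  also have "\<dots> \<sqsubseteq>\<^bsub>?L\<^esub> stell0_map n y"
    using m(1) assms(2) by (subst L_order_rook0_iff_mult) (auto simp: stell0_map_closed)
  finally show ?thesis
    using m(1) assms(1,2) by (simp add: stell0_map_closed)
qed

text \<open>A left multiple of y in the stellar monoid is St(m y), which lies below m y and so below
  y. Conversely x = m y gives x = St(m y) because x is fixed.\<close>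

lemma L_order_stell0_iff:
  assumes "x \<in> stell_carrier n" "y \<in> stell_carrier n"
  shows "x \<sqsubseteq>\<^bsub>L_order (stell0_monoid n)\<^esub> y \<longleftrightarrow> x \<sqsubseteq>\<^bsub>L_order (rook0_monoid n)\<^esub> y"
proof -
  let ?M = "rook0_monoid n" and ?K = "stell0_monoid n"
  interpret M: monoid ?M by (rule monoid_rook0)
  interpret L: lattice "L_order ?M" by (rule lattice_L_order_rook0)
  have M: "x \<in> carrier ?M" "y \<in> carrier ?M" and fixed: "stell0_map n x = x" "stell0_map n y = y"
    using assms by (auto simp: stell_carrier_eq stell0_map_closed stell0_map_idem)
  have hom: "stell0_map n m \<otimes>\<^bsub>?K\<^esub> y = stell0_map n (m \<otimes>\<^bsub>?M\<^esub> y)" if "m \<in> carrier ?M" for m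
    using hom_mult[OF stell0_monoid_props(3) that M(2)] fixed by simp
  have "x \<sqsubseteq>\<^bsub>L_order ?K\<^esub> y \<longleftrightarrow> (\<exists>m\<in>carrier ?K. x = m \<otimes>\<^bsub>?K\<^esub> y)"
    unfolding L_order_def
    using monoid.left_ideal_subset_iff[OF stell0_monoid_props(1)] assms stell0_monoid_props(2) by simp
  also have "\<dots> \<longleftrightarrow> (\<exists>m\<in>carrier ?M. x = stell0_map n (m \<otimes>\<^bsub>?M\<^esub> y))"
    using hom by (auto simp: stell0_monoid_props(2) stell_carrier_eq)
  also have "\<dots> \<longleftrightarrow> x \<sqsubseteq>\<^bsub>L_order ?M\<^esub> y"
  proof
    assume "\<exists>m\<in>carrier ?M. x = stell0_map n (m \<otimes>\<^bsub>?M\<^esub> y)"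
    then obtain m where m: "m \<in> carrier ?M" "x = stell0_map n (m \<otimes>\<^bsub>?M\<^esub> y)" by blast
    have "x \<sqsubseteq>\<^bsub>L_order ?M\<^esub> m \<otimes>\<^bsub>?M\<^esub> y"
      unfolding m(2) using m(1) M(2) by (intro L_order_stell0_map_le) simp
    moreover have "m \<otimes>\<^bsub>?M\<^esub> y \<sqsubseteq>\<^bsub>L_order ?M\<^esub> y"
      using m(1) M(2) by (subst L_order_rook0_iff_mult) auto
    ultimately show "x \<sqsubseteq>\<^bsub>L_order ?M\<^esub> y"
      using L.le_trans m(1) M by simp
  next
    assume "x \<sqsubseteq>\<^bsub>L_order ?M\<^esub> y"
    then obtain m where "m \<in> carrier ?M" "x = m \<otimes>\<^bsub>?M\<^esub> y" using L_order_rook0_iff_mult M by blast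
    then show "\<exists>m\<in>carrier ?M. x = stell0_map n (m \<otimes>\<^bsub>?M\<^esub> y)" using fixed(1) by metis
  qed
  finally show ?thesis .
qed

theorem theorem4p42:
  fixes n :: nat
  shows "sublattice (L_order (stell0_monoid n)) (L_order (rook0_monoid n))"
proof -
  let ?M = "rook0_monoid n" and ?L = "L_order (rook0_monoid n)"
  interpret L: lattice ?L by (rule lattice_L_order_rook0)
  have K: "x \<in> stell_carrier n \<longleftrightarrow> x \<in> carrier ?M \<and> stell0_map n x = x" for x
    by (auto simp: stell_carrier_eq stell0_map_closed stell0_map_idem)
  have join: "x \<squnion>\<^bsub>?L\<^esub> y \<in> stell_carrier n" if "x \<in> stell_carrier n" "y \<in> stell_carrier n" for x y
  proof -
    let ?j = "x \<squnion>\<^bsub>?L\<^esub> y"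
    have c: "x \<in> carrier ?L" "y \<in> carrier ?L" "?j \<in> carrier ?L" "?j \<in> carrier ?M" "stell0_map n ?j \<in> carrier ?L"
      using that K L.join_closed[of x y] stell0_map_closed by auto
    \<comment> \<open>By monotonicity the image of the join is still above the fixed points x and y,
      so it cannot be smaller than the join.\<close>
    have "x \<sqsubseteq>\<^bsub>?L\<^esub> stell0_map n ?j" "y \<sqsubseteq>\<^bsub>?L\<^esub> stell0_map n ?j"
      using stell0_map_mono[of x n ?j] stell0_map_mono[of y n ?j] c that K L.join_left L.join_right by auto
    then have "?j \<sqsubseteq>\<^bsub>?L\<^esub> stell0_map n ?j" using c by (intro L.join_le)
    then have "stell0_map n ?j = ?j"
      using L_order_stell0_map_le c by (intro L.le_antisym) auto
    with c show ?thesis by (simp add: K)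
  qed
  have meet: "x \<sqinter>\<^bsub>?L\<^esub> y \<in> stell_carrier n" if "x \<in> stell_carrier n" "y \<in> stell_carrier n" for x y
  proof -
    let ?m = "x \<sqinter>\<^bsub>?L\<^esub> y"
    have c: "x \<in> carrier ?M" "y \<in> carrier ?M" "?m \<in> carrier ?M"
      using that K L.meet_closed[of x y] by auto
    let ?q = "dual_rook n ?m"
    have rk: "dual_rook n z \<in> rooks n" if "z \<in> carrier ?M" for z
      using that by (rule dual_rook_rooks)
    \<comment> \<open>The closure of the meet. It lies above the meet and below every stellar
      element above it, in particular below x and y, so it equals the meet.\<close>
    obtain t where t: "t \<in> carrier ?M" "dual_rook n t = zeros_first ?q"
      using ex_dual_rook zeros_first_rooks rk c(3) by metis
    have below: "t \<sqsubseteq>\<^bsub>?L\<^esub> z" if z: "z \<in> stell_carrier n" "?m \<sqsubseteq>\<^bsub>?L\<^esub> z" for z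
    proof -
      have zc: "z \<in> carrier ?M" "clear_prefix (dual_rook n z) = dual_rook n z"
        using z K dual_rook_stell0_map[of z n] by auto
      have "rook_le ?q (dual_rook n z)"
        using z zc c rk[OF zc(1)] by (simp add: L_order_rook0_iff rook_le_of_reach rooks_iff)
      then have "rook_le (zeros_first ?q) (dual_rook n z)"
        using rook_le_zeros_first_mono zeros_first_clear_prefix zc(2) by metis
      then show ?thesis
        using zc t rk[OF zc(1)] rk[OF t(1)] rk[OF c(3)]
        by (simp add: L_order_rook0_iff reach_iff rooks_iff distinct_nz_zeros_first)
    qed
    have "?m \<sqsubseteq>\<^bsub>?L\<^esub> x" "?m \<sqsubseteq>\<^bsub>?L\<^esub> y" using c L.meet_left L.meet_right by auto
    then have "t \<sqsubseteq>\<^bsub>?L\<^esub> ?m" using below that c t by (intro L.meet_le) auto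
    moreover have "?m \<sqsubseteq>\<^bsub>?L\<^esub> t"
      using t c(3) rk[OF c(3)] rook_le_zeros_first
      by (simp add: L_order_rook0_iff reach_iff rooks_iff distinct_nz_zeros_first)
    ultimately have "t = ?m" using t c by (intro L.le_antisym) auto
    then have "dual_rook n (stell0_map n ?m) = dual_rook n ?m"
      using t c by (metis dual_rook_stell0_map clear_prefix_zeros_first)
    then have "stell0_map n ?m = ?m"
      using c by (intro dual_rook_inj) (auto simp: stell0_map_closed)
    with c show ?thesis by (simp add: K)
  qed
  have "stell_carrier n \<subseteq> carrier ?M" using K by blast
  then show ?thesis
    using join meet L_order_stell0_iff lattice_L_order_rook0
    by (simp add: sublattice_def stell0_monoid_props(2))
qed

end
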